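(* Let $(A,\sigma)$ be a totally decomposable algebra of degree $2^n$ with involution of orthogonal type over a field $F$ of characteristic $2$ and let $S\subseteq \mathrm{Sym}(A,\sigma)$ be a $\rho$-generated totally singular conic $F$-algebra such that $C_A(S)=S$. Let $\mathfrak{s}:S\times S\to F$ be the symmetric bilinear form for which $\mathfrak s(v,w)$ is the unique $\alpha\in F$ such that $vw+\alpha\in\mathrm{Alt}(A,\sigma)$, for $v,w\in S$. If $\mathfrak{s}\simeq\langle\!\langle\alpha_1,\dots,\alpha_n\rangle\!\rangle$ for some $\alpha_1,\dots,\alpha_n\in F^\times$, then there exists a set of alternating generators $\{u_1,\dots,u_n\}$ of $S$ such that $u_i^2=\alpha_i$ for $i=1,\dots,n$.
   Context: All algebras are unital and associative; subalgebras contain the unit of the ambient algebra; $F[v_1,\dots,v_n]$ is the $F$-subalgebra generated by $v_1,\dots,v_n$; $A^*$ is the group of invertible elements; $C_A(S)$ is the centralizer of $S$ in $A$; the degree of a central simple algebra is $\sqrt{\dim_F A}$. For a central simple $F$-algebra $A$ with involution $\sigma$ (anti-automorphism of order dividing $2$) of the first kind ($\sigma|_F=\mathrm{id}$), put $\mathrm{Alt}(A,\sigma)=\{a-\sigma(a):a\in A\}$ and $\mathrm{Sym}(A,\sigma)=\{a\in A:\sigma(a)=a\}$. In characteristic $2$, $\sigma$ is of orthogonal type if and only if $1\notin\mathrm{Alt}(A,\sigma)$ (equivalently, over a splitting field it is not adjoint to an alternating bilinear form). A quaternion algebra is a central simple algebra of degree $2$. $(A,\sigma)$ is totally decomposable if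 it decomposes as a tensor product of $\sigma$-invariant quaternion $F$-algebras with the restricted involutions (the empty tensor product being $(F,\mathrm{id})$). A totally singular conic $F$-algebra is an $F$-algebra $R$ with $x^2\in F$ for every $x\in R$. If $\mathrm{char}\,F=2$ and $R$ is finite dimensional, $R$ is a local commutative algebra with unique maximal ideal $\mathfrak m=\{x\in R:x^2=0\}$. The minimum rank $r_F(R)$ is the minimum number of elements generating $R$ as an $F$-algebra. The Loewy length $\ell\ell(R)$ is the smallest positive integer $l$ with $J(R)^l=0$, where $J(R)$ is the Jacobson radical. Such $R$ is called $\rho$-generated if $r_F(R)=\ell\ell(R)+r_F(R/\mathfrak m)-1$. For $(A,\sigma)$ and $S$ as in the claim one always has $S\subseteq\mathrm{Alt}(A,\sigma)+F$, and $F\cap\mathrm{Alt}(A,\sigma)=\{0\}$, so $\mathfrak s$ is well defined. A set of alternating generators of $S$ is a set $\{v_1,\dots,v_n\}\subseteq\mathrm{Alt}(A,\sigma)\cap A^*$ with $S=F[v_1,\dots,v_n]$ and $v_{i_1}\cdots v_{i_l}\in\mathrm{Alt}(A,\sigma)$ for all $1\le l\le n$ and $1\le i_1<\cdots<i_l\le n$. $\langle\!\langle\alpha_1,\dots,\alpha_n\rangle\!\rangle=\langle1,\alpha_1\rangle\otimes\cdots\otimes\langle1,\alpha_n\rangle$ is the bilinear $n$-fold Pfister form, where $\langle a,b\rangle$ is the diagonal symmetric bilinear form; $\simeq$ denotes isometry. *)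

theory Defs
  imports
    Complex_Main
    "HOL-Library.Function_Algebras"
    "HOL-Algebra.QuotRing"
    "HOL-Algebra.Ideal_Product"
    "HOL-Algebra.Generated_Rings"
begin

text \<open>
  The ambient algebra is a type \<open>'a\<close> of class \<^class>\<open>ring_1\<close> together with a scalar action \<open>scale\<close>
  of a field \<open>'f\<close>. Subalgebras are sets of elements. For ring-theoretic constructions
  (ideals, quotients) a subalgebra is turned into a ring record of HOL-Algebra by \<open>ring_of\<close>.
\<close>

locale unital_algebra = vector_space scale
  for scale :: "'f::field \<Rightarrow> 'a::ring_1 \<Rightarrow> 'a" +
  assumes mult_scale_left: "scale c x * y = scale c (x * y)"
    and mult_scale_right: "x * scale c y = scale c (x * y)"

definition scalars :: "('f::field \<Rightarrow> 'a::ring_1 \<Rightarrow> 'a) \<Rightarrow> 'a set" where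
  "scalars scale = range (\<lambda>c. scale c 1)"

definition is_subalgebra :: "('f::field \<Rightarrow> 'a::ring_1 \<Rightarrow> 'a) \<Rightarrow> 'a set \<Rightarrow> bool" where
  "is_subalgebra scale B \<longleftrightarrow>
     module.subspace scale B \<and> 1 \<in> B \<and> (\<forall>x\<in>B. \<forall>y\<in>B. x * y \<in> B)"

definition ring_of :: "'a::ring_1 set \<Rightarrow> 'a ring" where
  "ring_of B = \<lparr>carrier = B, mult = (*), one = 1, zero = 0, add = (+)\<rparr>"

definition centralizer :: "'a::ring_1 set \<Rightarrow> 'a set" where
  "centralizer B = {x. \<forall>y\<in>B. x * y = y * x}"


subsection \<open>Central simple algebras with involution\<close>

definition central_simple :: "('f::field \<Rightarrow> 'a::ring_1 \<Rightarrow> 'a) \<Rightarrow> 'a set \<Rightarrow> bool" where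
  "central_simple scale B \<longleftrightarrow>
     is_subalgebra scale B \<and>
     (\<exists>T. finite T \<and> B \<subseteq> module.span scale T) \<and>
     B \<inter> centralizer B = scalars scale \<and>
     (\<forall>I. ideal I (ring_of B) \<longrightarrow> I = {0} \<or> I = B)"

definition algebra_degree :: "('f::field \<Rightarrow> 'a::ring_1 \<Rightarrow> 'a) \<Rightarrow> 'a set \<Rightarrow> real" where
  "algebra_degree scale B = sqrt (real (vector_space.dim scale B))"

definition quaternion_algebra :: "('f::field \<Rightarrow> 'a::ring_1 \<Rightarrow> 'a) \<Rightarrow> 'a set \<Rightarrow> bool" where
  "quaternion_algebra scale B \<longleftrightarrow> central_simple scale B \<and> algebra_degree scale B = 2"

definition involution_first_kind ::
    "('f::field \<Rightarrow> 'a::ring_1 \<Rightarrow> 'a) \<Rightarrow> ('a \<Rightarrow> 'a) \<Rightarrow> bool" where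
  "involution_first_kind scale \<sigma> \<longleftrightarrow>
     (\<forall>x y. \<sigma> (x + y) = \<sigma> x + \<sigma> y) \<and>
     (\<forall>x y. \<sigma> (x * y) = \<sigma> y * \<sigma> x) \<and>
     (\<forall>x. \<sigma> (\<sigma> x) = x) \<and>
     (\<forall>c. \<sigma> (scale c 1) = scale c 1)"

definition Alt :: "('a::ring_1 \<Rightarrow> 'a) \<Rightarrow> 'a set" where
  "Alt \<sigma> = {a - \<sigma> a | a. True}"

definition Sym :: "('a::ring_1 \<Rightarrow> 'a) \<Rightarrow> 'a set" where
  "Sym \<sigma> = {a. \<sigma> a = a}"

text \<open>The following describes orthogonal type only in characteristic 2.\<close>

definition orthogonal_type :: "('a::ring_1 \<Rightarrow> 'a) \<Rightarrow> bool" where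
  "orthogonal_type \<sigma> \<longleftrightarrow> 1 \<notin> Alt \<sigma>"

text \<open>
  The ambient algebra is the (internal) tensor product of the subalgebras \<open>Q 0, \<dots>, Q (m - 1)\<close>:
  they commute elementwise and the multiplication map from their tensor product is bijective,
  i.e. the products of the members of some bases \<open>B i\<close> of \<open>Q i\<close> form, without repetition, a basis.
  For \<open>m = 0\<close> this says that \<open>{1}\<close> is a basis.
\<close>

definition internal_tensor_product ::
    "('f::field \<Rightarrow> 'a::ring_1 \<Rightarrow> 'a) \<Rightarrow> nat \<Rightarrow> (nat \<Rightarrow> 'a set) \<Rightarrow> bool" where
  "internal_tensor_product scale m Q \<longleftrightarrow>
     (\<forall>i<m. is_subalgebra scale (Q i)) \<and>
     (\<forall>i<m. \<forall>j<m. i \<noteq> j \<longrightarrow> (\<forall>x\<in>Q i. \<forall>y\<in>Q j. x * y = y * x)) \<and>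
     (\<exists>B. (\<forall>i<m. \<not> module.dependent scale (B i) \<and> module.span scale (B i) = Q i) \<and>
          (let P = (\<lambda>b. prod_list (map b [0..<m])) in
             inj_on P (PiE {..<m} B) \<and>
             \<not> module.dependent scale (P ` PiE {..<m} B) \<and>
             module.span scale (P ` PiE {..<m} B) = UNIV))"

definition totally_decomposable ::
    "('f::field \<Rightarrow> 'a::ring_1 \<Rightarrow> 'a) \<Rightarrow> ('a \<Rightarrow> 'a) \<Rightarrow> bool" where
  "totally_decomposable scale \<sigma> \<longleftrightarrow>
     (\<exists>m Q. internal_tensor_product scale m Q \<and>
            (\<forall>i<m. quaternion_algebra scale (Q i) \<and> \<sigma> ` Q i \<subseteq> Q i))"


subsection \<open>Totally singular conic algebras\<close>

definition totally_singular_conic ::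
    "('f::field \<Rightarrow> 'a::ring_1 \<Rightarrow> 'a) \<Rightarrow> 'a set \<Rightarrow> bool" where
  "totally_singular_conic scale R \<longleftrightarrow>
     is_subalgebra scale R \<and> (\<forall>x\<in>R. x\<^sup>2 \<in> scalars scale)"

text \<open>
  In the next two definitions an algebra over \<open>'f\<close> is a ring record \<open>R\<close> with its structure map
  \<open>\<iota> :: 'f \<Rightarrow> 'b\<close>; this covers subalgebras as well as their quotients.
\<close>

definition generated_algebra ::
    "('f \<Rightarrow> 'b) \<Rightarrow> ('b, 'c) ring_scheme \<Rightarrow> 'b set \<Rightarrow> 'b set" where
  "generated_algebra \<iota> R X = generate_ring R (range \<iota> \<union> X)"

definition min_rank :: "('f \<Rightarrow> 'b) \<Rightarrow> ('b, 'c) ring_scheme \<Rightarrow> nat" where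
  "min_rank \<iota> R = (LEAST k. \<exists>X. X \<subseteq> carrier R \<and> finite X \<and> card X = k \<and>
                                generated_algebra \<iota> R X = carrier R)"

text \<open>The Jacobson radical of a commutative ring; two-sided ideals do not suffice in general.\<close>

definition jacobson_radical :: "('b, 'c) ring_scheme \<Rightarrow> 'b set" where
  "jacobson_radical R = carrier R \<inter> \<Inter> {I. maximalideal I R}"

primrec ideal_power :: "('b, 'c) ring_scheme \<Rightarrow> 'b set \<Rightarrow> nat \<Rightarrow> 'b set" where
  "ideal_power R I 0 = carrier R"
| "ideal_power R I (Suc l) = ideal_prod R I (ideal_power R I l)"

definition loewy_length :: "('b, 'c) ring_scheme \<Rightarrow> nat" where
  "loewy_length R = (LEAST l. 0 < l \<and> ideal_power R (jacobson_radical R) l = {\<zero>\<^bsub>R\<^esub>})"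

definition square_zero_ideal :: "'a::ring_1 set \<Rightarrow> 'a set" where
  "square_zero_ideal R = {x \<in> R. x\<^sup>2 = 0}"

definition rho_generated :: "('f::field \<Rightarrow> 'a::ring_1 \<Rightarrow> 'a) \<Rightarrow> 'a set \<Rightarrow> bool" where
  "rho_generated scale R \<longleftrightarrow>
     (let m = square_zero_ideal R in
        min_rank (\<lambda>c. scale c 1) (ring_of R) =
          loewy_length (ring_of R)
          + min_rank (\<lambda>c. m +>\<^bsub>ring_of R\<^esub> scale c 1) (ring_of R Quot m) - 1)"

definition alternating_generators ::
    "('f::field \<Rightarrow> 'a::ring_1 \<Rightarrow> 'a) \<Rightarrow> ('a \<Rightarrow> 'a) \<Rightarrow> 'a set \<Rightarrow> nat \<Rightarrow> (nat \<Rightarrow> 'a) \<Rightarrow> bool" where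
  "alternating_generators scale \<sigma> S n v \<longleftrightarrow>
     (\<forall>i\<in>{1..n}. v i \<in> Alt \<sigma> \<inter> Units (ring_of UNIV)) \<and>
     S = generated_algebra (\<lambda>c. scale c 1) (ring_of UNIV) (v ` {1..n}) \<and>
     (\<forall>js. js \<noteq> [] \<and> sorted_wrt (<) js \<and> set js \<subseteq> {1..n} \<longrightarrow> prod_list (map v js) \<in> Alt \<sigma>)"

definition alt_form ::
    "('f::field \<Rightarrow> 'a::ring_1 \<Rightarrow> 'a) \<Rightarrow> ('a \<Rightarrow> 'a) \<Rightarrow> 'a \<Rightarrow> 'a \<Rightarrow> 'f" where
  "alt_form scale \<sigma> v w = (THE c. v * w + scale c 1 \<in> Alt \<sigma>)"


subsection \<open>Bilinear Pfister forms\<close>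

definition isometric ::
    "('f::field \<Rightarrow> 'v::ab_group_add \<Rightarrow> 'v) \<Rightarrow> 'v set \<Rightarrow> ('v \<Rightarrow> 'v \<Rightarrow> 'f) \<Rightarrow>
     ('f \<Rightarrow> 'w::ab_group_add \<Rightarrow> 'w) \<Rightarrow> 'w set \<Rightarrow> ('w \<Rightarrow> 'w \<Rightarrow> 'f) \<Rightarrow> bool" where
  "isometric scale1 V b1 scale2 W b2 \<longleftrightarrow>
     (\<exists>f. bij_betw f V W \<and>
          (\<forall>x\<in>V. \<forall>y\<in>V. f (x + y) = f x + f y) \<and>
          (\<forall>c. \<forall>x\<in>V. f (scale1 c x) = scale2 c (f x)) \<and>
          (\<forall>x\<in>V. \<forall>y\<in>V. b2 (f x) (f y) = b1 x y))"

text \<open>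
  The form \<open>\<langle>d\<^sub>0, \<dots>, d\<^sub>k\<^sub>-\<^sub>1\<rangle>\<close> is given by the list of its entries. It lives on the space of
  \<open>k\<close>-tuples, encoded as functions on \<^typ>\<open>nat\<close> vanishing from \<open>k\<close> on.
\<close>

definition coord_scale :: "'f::field \<Rightarrow> (nat \<Rightarrow> 'f) \<Rightarrow> nat \<Rightarrow> 'f" where
  "coord_scale c x = (\<lambda>i. c * x i)"

definition coord_space :: "nat \<Rightarrow> (nat \<Rightarrow> 'f::field) set" where
  "coord_space k = {x. \<forall>i\<ge>k. x i = 0}"

definition diag_form :: "'f::field list \<Rightarrow> (nat \<Rightarrow> 'f) \<Rightarrow> (nat \<Rightarrow> 'f) \<Rightarrow> 'f" where
  "diag_form ds x y = (\<Sum>i<length ds. ds ! i * x i * y i)"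

text \<open>The entries of a tensor product of diagonal forms, in the basis of tensors
  of basis vectors ordered lexicographically.\<close>

definition diag_tensor :: "'f::field list \<Rightarrow> 'f list \<Rightarrow> 'f list" where
  "diag_tensor as bs = [a * b. a \<leftarrow> as, b \<leftarrow> bs]"

primrec pfister_entries :: "'f::field list \<Rightarrow> 'f list" where
  "pfister_entries [] = [1]"
| "pfister_entries (\<alpha> # \<alpha>s) = diag_tensor [1, \<alpha>] (pfister_entries \<alpha>s)"

end

theory Submission
  imports Defs
begin

text \<open>
  Put \<open>s v = \<ss> (v, 1)\<close>. Then \<open>\<ss> (v, w) = s (v w)\<close>, and on the commutative algebra \<open>S\<close> squares
  are scalars and squaring is additive. It suffices to find \<open>u\<^sub>i \<in> S\<close> with \<open>u\<^sub>i\<^sup>2 = \<alpha>\<^sub>i\<close> such that \<open>s\<close> kills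
  every product of a nonempty set of distinct \<open>u\<^sub>i\<close>: such products lie in \<open>Alt (A, \<sigma>)\<close>, the
  products over two distinct sets are orthogonal because their product is a nonzero scalar times
  the product over the symmetric difference, and \<open>2\<^sup>n\<close> orthogonal vectors of nonzero length span \<open>S\<close>.

  The isometry provides an orthogonal basis \<open>e\<^sub>I\<close> of \<open>S\<close>, indexed by the subsets of \<open>{1..n}\<close>, with
  \<open>e\<^sub>I\<^sup>2 = \<Prod>i\<in>I. \<alpha>\<^sub>i\<close>. If the maximal ideal \<open>m\<close> of \<open>S\<close> is zero, an element is determined by its
  square, hence \<open>u\<^sub>i = e\<^bsub>{i}\<^esub>\<close> works at once. In general the square determines an element only modulo
  \<open>m\<close>; in particular \<open>e\<^bsub>{}\<^esub>\<close> may differ from \<open>1\<close>, and the \<open>u\<^sub>i\<close> have to be corrected by elements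
  of \<open>m\<close>. The corrections come from nondegeneracy (\<open>realize_functional\<close>): if multiplication by \<open>x\<close>
  is injective on a subspace \<open>B\<close>, every linear functional on \<open>B\<close> has the form \<open>h \<mapsto> s (x v h)\<close>. If
  \<open>x \<in> m\<close>, adding \<open>x v\<close> to an element does not change its square.

  This is applied in two stages. First, as long as some \<open>\<alpha>\<^sub>i\<close> has no square root in the algebra
  generated so far, the element \<open>e\<^bsub>{i}\<^esub> + x v\<close> is adjoined, where \<open>x\<close> is any nonzero element of \<open>m\<close>.
  The algebras obtained are fields, so multiplication by \<open>x\<close> is injective on them, and the process
  ends with \<open>k\<close> generators of a field \<open>K\<close> such that \<open>S = K \<oplus> m\<close> (\<open>adapted_residue_field\<close>,
  \<open>lift_residues\<close>).

  The hypothesis on \<open>\<rho>\<close>-generation enters now. By dimension, \<open>S\<close> needs at least \<open>n\<close> generators,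
  while \<open>S / m\<close> is generated by \<open>k\<close> elements. Hence the Loewy length is at least \<open>n - k + 1\<close>, which
  yields \<open>x\<^sub>1, \<dots>, x\<^sub>d \<in> m\<close> with \<open>d = n - k\<close> and \<open>x\<^sub>1 \<cdots> x\<^sub>d \<noteq> 0\<close> (\<open>nonzero_nil_product\<close>).

  Each of the \<open>d\<close> remaining \<open>\<alpha>\<^sub>i\<close> is \<open>p\<^sup>2\<close> for some \<open>p \<in> K\<close>. One adjoins \<open>p (1 + y)\<close> with \<open>y \<in> m\<close>
  chosen such that \<open>s (y h) = s h\<close> on the algebra \<open>B\<close> generated so far. The elements \<open>x\<^sub>j\<close> pay for
  these steps one at a time: taking \<open>y = x\<^sub>1 + x\<^sub>2 v\<close> leaves \<open>y x\<^sub>2 \<cdots> x\<^sub>d = x\<^sub>1 x\<^sub>2 \<cdots> x\<^sub>d\<close> unchanged since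
  \<open>x\<^sub>2\<^sup>2 = 0\<close>, so multiplication by \<open>x\<^sub>2 \<cdots> x\<^sub>d\<close> is injective on \<open>B + y B\<close> and the argument can be
  repeated (\<open>complete_adapted\<close>).
\<close>

section \<open>Totally singular conic algebras in characteristic two\<close>

text \<open>
  The ambient ring is not commutative, so products over finite sets of indices are taken in
  increasing order; they are used for families in a commutative subalgebra, where the order is
  immaterial.
\<close>

definition ordered_prod :: "(nat \<Rightarrow> 'a::monoid_mult) \<Rightarrow> nat set \<Rightarrow> 'a" where
  "ordered_prod u I = prod_list (map u (sorted_list_of_set I))"

lemma ordered_prod_empty [simp]: "ordered_prod u {} = 1"
  by (simp add: ordered_prod_def)

lemma ordered_prod_cong:
  assumes "finite I" "\<And>i. i \<in> I \<Longrightarrow> u i = v i"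
  shows "ordered_prod u I = ordered_prod v I"
  unfolding ordered_prod_def using assms by (auto intro!: arg_cong[where f = prod_list])

lemma ordered_prod_set:
  assumes "sorted_wrt (<) js"
  shows "ordered_prod u (set js) = prod_list (map u js)"
proof -
  have "sorted_list_of_set (set js) = js"
    using assms by (metis finite_set strict_sorted_equal strict_sorted_list_of_set set_sorted_list_of_set)
  thus ?thesis by (simp add: ordered_prod_def)
qed

locale conic_subalgebra = unital_algebra scale
  for scale :: "'f::field \<Rightarrow> 'a::ring_1 \<Rightarrow> 'a" +
  fixes S :: "'a set"
  assumes char_two: "CHAR('f) = 2"
    and subalgebra: "is_subalgebra scale S"
    and commute: "\<And>x y. \<lbrakk>x \<in> S; y \<in> S\<rbrakk> \<Longrightarrow> x * y = y * x"
    and square_in_scalars: "\<And>x. x \<in> S \<Longrightarrow> x * x \<in> scalars scale"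
begin

lemma S_subspace: "subspace S"
  and S_one: "1 \<in> S"
  and S_mult: "x \<in> S \<Longrightarrow> y \<in> S \<Longrightarrow> x * y \<in> S"
  using subalgebra by (auto simp: is_subalgebra_def)

lemmas S_add = subspace_add[OF S_subspace]
lemmas S_scale = subspace_scale[OF S_subspace]
lemmas S_zero = subspace_0[OF S_subspace]
lemmas S_sum = subspace_sum[OF S_subspace]

lemma field_double: "(c::'f) + c = 0"
  by (metis char_two mult_2 mult_zero_left of_nat_CHAR of_nat_numeral)

lemma double: "(x::'a) + x = 0"
proof -
  have "x + x = scale (1 + 1) x" by (simp only: scale_left_distrib scale_one)
  thus ?thesis by (simp only: field_double scale_zero_left)
qed

lemma uminus_eq: "- (x::'a) = x"
  using double by (simp add: minus_unique)

lemma diff_eq: "(x::'a) - y = x + y"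
  by (metis diff_conv_add_uminus uminus_eq)

lemma add_cancel_eq: "(x::'a) + y = 0 \<longleftrightarrow> x = y"
  by (metis diff_eq eq_iff_diff_eq_0)

lemma add_add_self: "(x::'a) + (x + y) = y"
  by (metis add.assoc add_0 double)

lemma scale_one_mult [simp]: "scale c 1 * x = scale c x" "x * scale c 1 = scale c x"
  by (simp_all add: mult_scale_left mult_scale_right)

lemma left_commute: "x \<in> S \<Longrightarrow> y \<in> S \<Longrightarrow> x * (y * z) = y * (x * z)"
  by (metis commute mult.assoc)

lemma square_mult:
  assumes "x \<in> S" "y \<in> S"
  shows "(x * y) * (x * y) = (x * x) * (y * y)"
  using assms by (metis commute mult.assoc)

lemma square_add:
  assumes "x \<in> S" "y \<in> S"
  shows "(x + y) * (x + y) = x * x + y * y"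
proof -
  have "(x + y) * (x + y) = x * x + (x * y + (x * y + y * y))"
    using commute[OF assms] by (simp add: algebra_simps)
  thus ?thesis by (simp add: add_add_self)
qed

abbreviation nil :: "'a set" where
  "nil \<equiv> square_zero_ideal S"

lemma nil_iff: "x \<in> nil \<longleftrightarrow> x \<in> S \<and> x * x = 0"
  by (simp add: square_zero_ideal_def power2_eq_square)

lemma nil_in_S: "x \<in> nil \<Longrightarrow> x \<in> S"
  by (simp add: nil_iff)

lemma nil_zero: "0 \<in> nil"
  by (simp add: nil_iff S_zero)

lemma nil_add: "x \<in> nil \<Longrightarrow> y \<in> nil \<Longrightarrow> x + y \<in> nil"
  by (simp add: nil_iff S_add square_add)

lemma nil_mult:
  assumes "x \<in> nil" "y \<in> S"
  shows "x * y \<in> nil" "y * x \<in> nil"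
  using assms square_mult[of x y] square_mult[of y x] by (auto simp: nil_iff S_mult)

lemma nil_add_iff: "x \<in> S \<Longrightarrow> y \<in> S \<Longrightarrow> x + y \<in> nil \<longleftrightarrow> x * x = y * y"
  by (simp add: nil_iff S_add square_add add_cancel_eq)

text \<open>
  The inverse of \<open>x\<close> is a scalar multiple of \<open>x\<close>, whence it lies in every subspace through \<open>x\<close>.
\<close>

lemma inverse_in_subspace:
  assumes "x \<in> S" "x * x \<noteq> 0" "subspace B" "x \<in> B"
  shows "\<exists>y\<in>B. x * y = 1"
proof -
  obtain c where c: "x * x = scale c 1"
    using square_in_scalars[OF assms(1)] by (auto simp: scalars_def)
  hence "c \<noteq> 0" using assms(2) by auto
  hence "x * scale (1 / c) x = 1"
    by (simp add: mult_scale_right c)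
  thus ?thesis using assms(3,4) subspace_scale by blast
qed

lemma unit_mult_nonzero:
  assumes "x \<in> S" "x * x \<noteq> 0" "y \<noteq> 0"
  shows "y * x \<noteq> 0"
proof -
  obtain z where "x * z = 1"
    using inverse_in_subspace[OF assms(1,2) S_subspace assms(1)] by blast
  thus ?thesis using assms(3) by (metis mult.assoc mult_1_right mult_zero_left)
qed


subsection \<open>Subalgebras generated by finitely many elements\<close>

text \<open>
  As squares are scalars, the products of distinct generators span; so the generated subalgebra
  is introduced as this span, which makes adjoining one generator transparent.
\<close>

definition alg :: "(nat \<Rightarrow> 'a) \<Rightarrow> nat set \<Rightarrow> 'a set" where
  "alg u A = span (ordered_prod u ` Pow A)"

lemma alg_subspace: "subspace (alg u A)"
  by (simp add: alg_def)

lemmas alg_add = subspace_add[OF alg_subspace]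
lemmas alg_scale = subspace_scale[OF alg_subspace]
lemmas alg_zero = subspace_0[OF alg_subspace]

lemma ordered_prod_in_alg: "I \<subseteq> A \<Longrightarrow> ordered_prod u I \<in> alg u A"
  unfolding alg_def by (rule span_base) blast

lemma alg_one: "1 \<in> alg u A"
  using ordered_prod_in_alg[of "{}" A u] by simp

lemma alg_empty: "alg u {} = scalars scale"
  by (auto simp: alg_def scalars_def span_singleton)

lemma alg_cong: "finite A \<Longrightarrow> (\<And>i. i \<in> A \<Longrightarrow> u i = v i) \<Longrightarrow> alg u A = alg v A"
  unfolding alg_def
  by (rule arg_cong[where f = span], rule image_cong) (auto intro!: ordered_prod_cong finite_subset[of _ A])

lemma ordered_prod_in_S:
  assumes "finite I" "\<And>i. i \<in> I \<Longrightarrow> u i \<in> S"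
  shows "ordered_prod u I \<in> S"
proof -
  have "set js \<subseteq> I \<Longrightarrow> prod_list (map u js) \<in> S" for js
    by (induction js) (auto simp: S_one S_mult assms(2))
  thus ?thesis by (simp add: ordered_prod_def assms(1))
qed

lemma ordered_prod_insert:
  assumes "finite I" "i \<notin> I" "\<And>j. j \<in> insert i I \<Longrightarrow> u j \<in> S"
  shows "ordered_prod u (insert i I) = u i * ordered_prod u I"
proof -
  have "set js \<subseteq> I \<Longrightarrow> prod_list (map u (insort i js)) = u i * prod_list (map u js)" for js
    by (induction js) (auto simp: left_commute assms(3))
  thus ?thesis using assms(1,2) by (simp add: ordered_prod_def)
qed

lemma ordered_prod_square:
  assumes "finite I" "\<And>i. i \<in> I \<Longrightarrow> u i \<in> S \<and> u i * u i = scale (c i) 1"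
  shows "ordered_prod u I * ordered_prod u I = scale (\<Prod>i\<in>I. c i) 1"
  using assms
proof (induction I)
  case (insert i I)
  have "ordered_prod u (insert i I) = u i * ordered_prod u I" "ordered_prod u I \<in> S"
    using insert.hyps insert.prems by (auto intro!: ordered_prod_insert ordered_prod_in_S)
  thus ?case
    using insert by (simp add: square_mult)
qed simp

lemma alg_in_S:
  assumes "finite A" "\<And>i. i \<in> A \<Longrightarrow> u i \<in> S" "x \<in> alg u A"
  shows "x \<in> S"
proof -
  have "ordered_prod u ` Pow A \<subseteq> S"
    using assms(1,2) by (auto intro!: ordered_prod_in_S dest: finite_subset)
  thus ?thesis using assms(3) span_minimal[OF _ S_subspace] by (auto simp: alg_def)
qed

lemma module_hom_mult: "module_hom scale scale ((*) x)"
  by unfold_locales (simp_all add: algebra_simps mult_scale_right scale_right_distrib scale_left_distrib)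

lemma alg_insert:
  assumes "finite A" "i \<notin> A" "\<And>j. j \<in> insert i A \<Longrightarrow> u j \<in> S"
  shows "alg u (insert i A) = {a + u i * b | a b. a \<in> alg u A \<and> b \<in> alg u A}"
proof -
  let ?P = "ordered_prod u ` Pow A"
  have "ordered_prod u (insert i I) = u i * ordered_prod u I" if "I \<subseteq> A" for I
    using assms that by (intro ordered_prod_insert) (auto dest: finite_subset)
  hence "ordered_prod u ` insert i ` Pow A = (*) (u i) ` ?P"
    by (auto simp: image_image image_iff)
  hence "ordered_prod u ` Pow (insert i A) = ?P \<union> (*) (u i) ` ?P"
    by (simp add: Pow_insert image_Un)
  thus ?thesis
    by (auto simp: alg_def span_Un module_hom.span_image[OF module_hom_mult])
qed

lemma alg_mult:
  assumes "finite A" "\<And>i. i \<in> A \<Longrightarrow> u i \<in> S" "x \<in> alg u A" "y \<in> alg u A"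
  shows "x * y \<in> alg u A"
  using assms
proof (induction A arbitrary: x y)
  case empty
  thus ?case by (auto simp: alg_empty scalars_def mult_scale_left)
next
  case (insert i A)
  have ins: "alg u (insert i A) = {a + u i * b | a b. a \<in> alg u A \<and> b \<in> alg u A}"
    using insert by (intro alg_insert) auto
  obtain a b c d where xy: "x = a + u i * b" "y = c + u i * d"
    and abcd: "a \<in> alg u A" "b \<in> alg u A" "c \<in> alg u A" "d \<in> alg u A"
    using insert.prems(2,3) ins by blast
  have S: "u i \<in> S" "a \<in> S" "b \<in> S" "c \<in> S" "d \<in> S"
    using abcd insert.prems(1) alg_in_S[OF insert.hyps(1), of u] by auto
  obtain k where k: "u i * u i = scale k 1"
    using square_in_scalars[OF S(1)] by (auto simp: scalars_def)
  have "u i * b * (u i * d) = (u i * u i) * (b * d)"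
    using S by (simp add: mult.assoc left_commute[of b "u i"])
  hence "u i * b * (u i * d) = scale k (b * d)" by (simp add: k)
  moreover have "a * (u i * d) = u i * (a * d)" "u i * b * c = u i * (b * c)"
    using S by (simp_all add: left_commute mult.assoc)
  ultimately have "x * y = (a * c + scale k (b * d)) + u i * (a * d + b * c)"
    unfolding xy by (simp add: distrib_left distrib_right add_ac)
  moreover have "a * c + scale k (b * d) \<in> alg u A" "a * d + b * c \<in> alg u A"
    using abcd insert.prems(1) by (intro alg_add alg_scale insert.IH; simp)+
  ultimately show ?case using ins by blast
qed

lemma generator_in_alg: "finite A \<Longrightarrow> i \<in> A \<Longrightarrow> u i \<in> alg u A"
  using ordered_prod_in_alg[of "{i}" A u] by (simp add: ordered_prod_def)

end

section \<open>Forms with an orthogonal basis of Pfister type\<close>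

declare One_nat_def [simp del]

lemma vector_space_field: "vector_space ((*) :: 'f::field \<Rightarrow> 'f \<Rightarrow> 'f)"
  by unfold_locales (simp_all add: distrib_left distrib_right mult.assoc)

text \<open>
  The functional \<open>s\<close> stands for \<open>v \<mapsto> \<ss> (v, 1)\<close>, extended to a linear map on the whole
  ambient algebra so that it composes with other linear maps. The vectors \<open>e I\<close> are the images of the standard
  basis of the Pfister form, indexed by sets of slots instead of positions; \<open>e {}\<close> has length
  \<open>1\<close> but need not be the unit.
\<close>

locale pfister_functional = conic_subalgebra scale S
  for scale :: "'f::field \<Rightarrow> 'a::ring_1 \<Rightarrow> 'a" and S :: "'a set" +
  fixes s :: "'a \<Rightarrow> 'f" and n :: nat and \<alpha> :: "nat \<Rightarrow> 'f" and e :: "nat set \<Rightarrow> 'a"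
  assumes functional: "module_hom scale (*) s"
    and s_one: "s 1 = 1"
    and \<alpha>_nonzero: "\<And>i. i \<in> {1..n} \<Longrightarrow> \<alpha> i \<noteq> 0"
    and e_in_S: "\<And>I. I \<subseteq> {1..n} \<Longrightarrow> e I \<in> S"
    and e_orthogonal: "\<And>I J. \<lbrakk>I \<subseteq> {1..n}; J \<subseteq> {1..n}\<rbrakk> \<Longrightarrow>
          s (e I * e J) = (if I = J then \<Prod>i\<in>I. \<alpha> i else 0)"
    and S_span: "S = span (e ` Pow {1..n})"
begin

sublocale s: module_hom scale "(*)" s
  by (rule functional)

lemma finite_sub: "I \<subseteq> {1..n} \<Longrightarrow> finite I"
  by (rule finite_subset) auto

lemma prod_nonzero: "I \<subseteq> {1..n} \<Longrightarrow> (\<Prod>i\<in>I. \<alpha> i) \<noteq> 0"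
  using \<alpha>_nonzero finite_sub by auto

lemma s_scale_one: "s (scale c 1) = c"
  by (simp add: s.scale s_one)

lemma e_square: "I \<subseteq> {1..n} \<Longrightarrow> e I * e I = scale (\<Prod>i\<in>I. \<alpha> i) 1"
  using square_in_scalars[OF e_in_S, of I] e_orthogonal[of I I]
  by (auto simp: scalars_def s_scale_one)

lemma functional_mult: "module_hom scale (*) (\<lambda>h. s (x * h))"
proof -
  interpret module_hom scale scale "(*) x" by (rule module_hom_mult)
  show ?thesis by unfold_locales (simp_all add: s.add s.scale add scale algebra_simps)
qed

text \<open>
  The form \<open>s (v w)\<close> is nondegenerate: coordinates of \<open>v\<close> are read off from the orthogonal basis.
\<close>

lemma represent_functional:
  assumes "module_hom scale (*) g"
  shows "\<exists>v\<in>S. \<forall>w\<in>S. s (v * w) = g w"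
proof -
  interpret g: module_hom scale "(*)" g by fact
  define v where "v = (\<Sum>I\<in>Pow {1..n}. scale (g (e I) / (\<Prod>i\<in>I. \<alpha> i)) (e I))"
  have "s (v * e J) = g (e J)" if J: "J \<subseteq> {1..n}" for J
  proof -
    have "s (v * e J) = (\<Sum>I\<in>Pow {1..n}. g (e I) / (\<Prod>i\<in>I. \<alpha> i) * s (e I * e J))"
      by (simp add: v_def sum_distrib_right mult_scale_left s.sum s.scale)
    also have "\<dots> = (\<Sum>I\<in>Pow {1..n}. if I = J then g (e J) else 0)"
      using J prod_nonzero[OF J] by (intro sum.cong) (auto simp: e_orthogonal)
    finally show ?thesis using J by simp
  qed
  moreover have "v \<in> S"
    unfolding v_def by (intro S_sum) (auto intro: S_scale e_in_S)
  moreover have "subspace {w. s (v * w) = g w}"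
    by (auto simp: subspace_def distrib_left mult_scale_right s.add s.scale g.add g.scale g.zero s.zero)
  ultimately show ?thesis
    using span_minimal[of "e ` Pow {1..n}" "{w. s (v * w) = g w}"]
    by (intro bexI[of _ v]) (auto simp: S_span[symmetric])
qed

text \<open>
  The source of all corrections. A functional on \<open>B\<close> is transported to \<open>x B\<close> by injectivity, extended
  linearly, and then represented by some \<open>v\<close> by nondegeneracy.
\<close>

lemma realize_functional:
  assumes "subspace B" "x \<in> S" "B \<subseteq> S" and inj: "\<And>h. h \<in> B \<Longrightarrow> h \<noteq> 0 \<Longrightarrow> x * h \<noteq> 0"
    and \<phi>: "module_hom scale (*) \<phi>"
  shows "\<exists>v\<in>S. \<forall>h\<in>B. s (x * v * h) = \<phi> h"
proof -
  interpret VS: vector_space_pair scale scale by unfold_locales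
  interpret VF: vector_space_pair scale "(*) :: 'f \<Rightarrow> 'f \<Rightarrow> 'f"
    by (intro vector_space_pair.intro vector_space_axioms vector_space_field)
  interpret \<phi>: module_hom scale "(*)" \<phi> by fact
  have lin: "Vector_Spaces.linear scale scale ((*) x)"
    using module_hom_mult[of x] by (simp add: linear_iff_module_hom)
  obtain C where C: "C \<subseteq> B" "independent C" "B \<subseteq> span C"
    using maximal_independent_subset by blast
  have span_C: "span C \<subseteq> B" using C(1) assms(1) by (rule span_minimal)
  have inj_on: "inj_on ((*) x) (span C)"
  proof (rule inj_onI)
    fix a b assume ab: "a \<in> span C" "b \<in> span C" "x * a = x * b"
    hence "x * (a - b) = 0" "a - b \<in> B"
      using span_C assms(1) subspace_diff by (auto simp: right_diff_distrib)
    thus "a = b" using inj[of "a - b"] by auto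
  qed
  obtain g where g: "Vector_Spaces.linear scale (*) g"
    "\<And>y. y \<in> (*) x ` C \<Longrightarrow> g y = \<phi> (inv_into C ((*) x) y)"
    using VF.linear_independent_extend[OF VS.linear_independent_injective_image[OF lin C(2) inj_on],
        of "\<lambda>y. \<phi> (inv_into C ((*) x) y)"]
    by blast
  interpret g: module_hom scale "(*)" g
    using g(1) by (simp add: linear_iff_module_hom)
  have "inj_on ((*) x) C" using inj_on span_superset by (rule inj_on_subset)
  hence "g (x * h) = \<phi> h" if "h \<in> C" for h
    using g(2)[of "x * h"] that by simp
  moreover have "subspace {h. g (x * h) = \<phi> h}"
    by (auto simp: subspace_def distrib_left mult_scale_right g.add g.scale \<phi>.add \<phi>.scale g.zero \<phi>.zero)
  ultimately have gx: "g (x * h) = \<phi> h" if "h \<in> B" for h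
    using span_minimal[of C "{h. g (x * h) = \<phi> h}"] C(3) that by blast
  obtain v where v: "v \<in> S" "\<forall>w\<in>S. s (v * w) = g w"
    using represent_functional[OF g.module_hom_axioms] by blast
  have "s (x * v * h) = \<phi> h" if "h \<in> B" for h
  proof -
    have "x * v * h = v * (x * h)"
      using assms(2) v(1) by (simp add: commute mult.assoc)
    thus ?thesis using v gx[OF that] assms(2,3) that by (auto simp: S_mult)
  qed
  thus ?thesis using v(1) by blast
qed

lemma orthogonal_independent:
  assumes "finite X" "\<And>x y. \<lbrakk>x \<in> X; y \<in> X; x \<noteq> y\<rbrakk> \<Longrightarrow> s (x * y) = 0" "\<And>x. x \<in> X \<Longrightarrow> s (x * x) \<noteq> 0"
  shows "independent X"
proof (rule independent_if_scalars_zero[OF assms(1)])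
  fix c y assume 0: "(\<Sum>x\<in>X. scale (c x) x) = 0" and y: "y \<in> X"
  have "0 = s ((\<Sum>x\<in>X. scale (c x) x) * y)" by (simp add: 0 s.zero)
  also have "\<dots> = (\<Sum>x\<in>X. c x * s (x * y))"
    by (simp add: sum_distrib_right mult_scale_left s.sum s.scale)
  also have "\<dots> = (\<Sum>x\<in>X. if x = y then c y * s (y * y) else 0)"
    using assms(2) y by (intro sum.cong) auto
  finally show "c y = 0" using assms y by simp
qed

lemma orthogonal_family_independent:
  assumes "\<And>I J. \<lbrakk>I \<subseteq> {1..n}; J \<subseteq> {1..n}\<rbrakk> \<Longrightarrow> s (b I * b J) = (if I = J then \<Prod>i\<in>I. \<alpha> i else 0)"
  shows "independent (b ` Pow {1..n})" "card (b ` Pow {1..n}) = 2 ^ n"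
proof -
  have "inj_on b (Pow {1..n})"
    by (rule inj_onI) (metis PowD assms prod_nonzero)
  thus "card (b ` Pow {1..n}) = 2 ^ n" by (simp add: card_image card_Pow)
  show "independent (b ` Pow {1..n})"
    using \<alpha>_nonzero by (intro orthogonal_independent) (auto simp: assms finite_sub subset_iff)
qed


section \<open>Adapted families\<close>

text \<open>
  The condition on \<open>s\<close> says that all nonempty products of the family lie in \<open>Alt (A, \<sigma>)\<close>. It depends on the
  set \<open>A\<close> only, not on the order in which the generators are found; this matters since the slots
  that enlarge the residue field have to be treated first.
\<close>

definition adapted :: "nat set \<Rightarrow> (nat \<Rightarrow> 'a) \<Rightarrow> bool" where
  "adapted A u \<longleftrightarrow> A \<subseteq> {1..n} \<and> (\<forall>i\<in>A. u i \<in> S \<and> u i * u i = scale (\<alpha> i) 1) \<and>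
     (\<forall>I\<subseteq>A. I \<noteq> {} \<longrightarrow> s (ordered_prod u I) = 0)"

lemma adapted_finite: "adapted A u \<Longrightarrow> finite A"
  by (simp add: adapted_def finite_sub)

lemma adapted_in_S: "adapted A u \<Longrightarrow> i \<in> A \<Longrightarrow> u i \<in> S"
  by (simp add: adapted_def)

lemma adapted_alg_S: "adapted A u \<Longrightarrow> x \<in> alg u A \<Longrightarrow> x \<in> S"
  using alg_in_S[OF adapted_finite] adapted_in_S by metis

lemma adapted_alg_mult: "adapted A u \<Longrightarrow> x \<in> alg u A \<Longrightarrow> y \<in> alg u A \<Longrightarrow> x * y \<in> alg u A"
  using alg_mult[OF adapted_finite] adapted_in_S by metis

text \<open>
  One new generator orthogonal to the algebra generated so far is all that is needed, because every
  product of generators that involves \<open>w\<close> is \<open>w\<close> times an element of that algebra.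
\<close>

lemma adapted_insert:
  assumes A: "adapted A u" and i: "i \<in> {1..n}" "i \<notin> A"
    and w: "w \<in> S" "w * w = scale (\<alpha> i) 1" "\<And>h. h \<in> alg u A \<Longrightarrow> s (w * h) = 0"
  shows "adapted (insert i A) (u(i := w))"
    and "alg (u(i := w)) (insert i A) = {a + w * b | a b. a \<in> alg u A \<and> b \<in> alg u A}"
proof -
  let ?u = "u(i := w)"
  have S: "?u j \<in> S" if "j \<in> insert i A" for j
    using that w(1) adapted_in_S[OF A] i(2) by auto
  have alg: "alg ?u A = alg u A"
    using adapted_finite[OF A] i(2) by (intro alg_cong) auto
  have fin: "finite A" by (rule adapted_finite[OF A])
  show "alg ?u (insert i A) = {a + w * b | a b. a \<in> alg u A \<and> b \<in> alg u A}"
    using alg_insert[OF fin i(2), of ?u] S alg by simp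
  have "s (ordered_prod ?u I) = 0" if I: "I \<subseteq> insert i A" "I \<noteq> {}" for I
  proof (cases "i \<in> I")
    case True
    define J where "J = I - {i}"
    have J: "I = insert i J" "i \<notin> J" "J \<subseteq> A" "finite J"
      using True I fin by (auto simp: J_def intro: finite_subset)
    have "ordered_prod ?u I = w * ordered_prod ?u J"
      using ordered_prod_insert[OF J(4,2), of ?u] S J by auto
    thus ?thesis using w(3) ordered_prod_in_alg[OF J(3), of ?u] alg by simp
  next
    case False
    hence "I \<subseteq> A" using I by auto
    moreover from this have "ordered_prod ?u I = ordered_prod u I"
      using False fin by (intro ordered_prod_cong) (auto intro: finite_subset)
    ultimately show ?thesis using A I(2) by (simp add: adapted_def)
  qed
  thus "adapted (insert i A) ?u"
    using A i w by (auto simp: adapted_def)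
qed

lemma s_add_self: "s h + s h = 0"
  by (rule field_double)

text \<open>
  The second stage. Each step uses up one factor of the nonzero product of nilpotents. The
  invariant is that multiplication by the product of the remaining factors is injective on the algebra
  generated so far, which lets functionals on it be realized by elements of the maximal ideal.
\<close>

lemma complete_adapted:
  assumes "adapted A u" "length xs = card ({1..n} - A)" "set xs \<subseteq> nil"
    and "\<And>h. h \<in> alg u A \<Longrightarrow> h \<noteq> 0 \<Longrightarrow> prod_list xs * h \<noteq> 0"
    and "\<And>i. i \<in> {1..n} - A \<Longrightarrow> \<exists>p\<in>alg u A. p * p = scale (\<alpha> i) 1"
  shows "\<exists>v. adapted {1..n} v"
  using assms
proof (induction xs arbitrary: A u)
  case Nil
  hence "{1..n} - A = {}" by simp
  hence "A = {1..n}" using Nil.prems(1) by (auto simp: adapted_def)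
  thus ?case using Nil.prems(1) by blast
next
  case (Cons x xs)
  note A = Cons.prems(1)
  let ?B = "alg u A"
  have BS: "?B \<subseteq> S" using adapted_alg_S[OF A] by blast
  have xS: "x \<in> S" "x \<in> nil" "set xs \<subseteq> nil" using Cons.prems(3) nil_in_S by auto
  have inj: "x * (prod_list xs * h) \<noteq> 0" if "h \<in> ?B" "h \<noteq> 0" for h
    using Cons.prems(4)[OF that] by (simp add: mult.assoc)
  \<comment> \<open>For the last factor any \<open>y\<close> adjusting \<open>s\<close> will do, as no injectivity has to be preserved.\<close>
  have "\<exists>y\<in>nil. (\<forall>h\<in>?B. s (y * h) = s h) \<and>
          (xs \<noteq> [] \<longrightarrow> prod_list xs \<in> S \<and> prod_list xs * y = prod_list xs * x)"
  proof (cases xs)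
    case Nil
    then obtain v where "v \<in> S" "\<forall>h\<in>?B. s (x * v * h) = s h"
      using realize_functional[OF alg_subspace xS(1) BS _ functional] inj by auto
    thus ?thesis using Nil xS nil_mult by blast
  next
    case (Cons x' zs)
    have x': "x' \<in> nil" "x' \<in> S" "x' * x' = 0" using xS(3) Cons by (auto simp: nil_iff)
    have "set zs \<subseteq> S" using xS(3) Cons nil_in_S by auto
    hence zs: "prod_list zs \<in> S" by (induction zs) (auto simp: S_one S_mult)
    have "x' * h \<noteq> 0" if "h \<in> ?B" "h \<noteq> 0" for h
    proof
      assume 0: "x' * h = 0"
      have "x * (prod_list xs * h) = x * (prod_list zs * (x' * h))"
        using Cons x'(2) zs by (simp add: commute[of x'] mult.assoc)
      thus False using inj[OF that] 0 by simp
    qed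
    moreover have "module_hom scale (*) (\<lambda>h. s h + s (x * h))"
      using functional_mult[of "1 + x"] by (simp add: distrib_right s.add)
    ultimately obtain v where v: "v \<in> S" "\<forall>h\<in>?B. s (x' * v * h) = s h + s (x * h)"
      using realize_functional[OF alg_subspace x'(2) BS] by blast
    \<comment> \<open>The summand \<open>x\<close> keeps the product with \<open>xs\<close> intact; the term \<open>x' * v\<close> adjusts \<open>s\<close> and is killed by \<open>x'\<close>.\<close>
    define y where "y = x + x' * v"
    have "y \<in> nil" using xS x' v by (simp add: y_def nil_add nil_mult)
    moreover have "s (y * h) = s h" if "h \<in> ?B" for h
    proof -
      have "s (y * h) = s (x * h) + (s h + s (x * h))"
        using v(2) that by (simp only: y_def distrib_right s.add)
      thus ?thesis by (metis add.left_commute add_0_right s_add_self)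
    qed
    moreover have "prod_list xs * y = prod_list xs * x"
    proof -
      have "prod_list xs * (x' * v) = prod_list zs * (x' * x') * v"
        using Cons x'(2) zs by (simp add: commute[of x' "prod_list zs"] mult.assoc)
      thus ?thesis by (simp add: y_def distrib_left x'(3))
    qed
    moreover have "prod_list xs \<in> S" using Cons x' zs by (simp add: S_mult)
    ultimately show ?thesis by blast
  qed
  then obtain y where y: "y \<in> nil" "\<And>h. h \<in> ?B \<Longrightarrow> s (y * h) = s h"
    "xs \<noteq> [] \<Longrightarrow> prod_list xs \<in> S" "xs \<noteq> [] \<Longrightarrow> prod_list xs * y = prod_list xs * x" by blast
  have y_S: "y \<in> S" "y * y = 0" using y(1) by (auto simp: nil_iff)
  have "card ({1..n} - A) > 0" using Cons.prems(2) by (metis length_Cons zero_less_Suc)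
  then obtain i where i: "i \<in> {1..n} - A" by (metis card_gt_0_iff ex_in_conv)
  obtain p where p: "p \<in> ?B" "p * p = scale (\<alpha> i) 1" using Cons.prems(5)[OF i] by blast
  have pS: "p \<in> S" using p BS by blast
  define w where "w = p * (1 + y)"
  have wS: "w \<in> S" using pS y_S by (simp add: w_def S_mult S_add S_one)
  have w2: "w * w = scale (\<alpha> i) 1"
    using pS y_S by (simp add: w_def square_mult square_add S_add S_one p(2))
  have sw: "s (w * h) = 0" if "h \<in> ?B" for h
  proof -
    have "p * h \<in> ?B" using adapted_alg_mult[OF A p(1) that] .
    moreover have "w * h = p * h + y * (p * h)"
      using pS y_S by (simp add: w_def distrib_left distrib_right commute[of p y] mult.assoc)
    ultimately show ?thesis using y(2) s_add_self by (simp add: s.add)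
  qed
  let ?u = "u(i := w)"
  have A': "adapted (insert i A) ?u"
    and alg': "alg ?u (insert i A) = {a + w * b | a b. a \<in> ?B \<and> b \<in> ?B}"
    using adapted_insert[OF A _ _ wS w2 sw] i by auto
  have "prod_list xs * h \<noteq> 0" if h: "h \<in> alg ?u (insert i A)" "h \<noteq> 0" for h
  proof (cases "xs = []")
    case False
    obtain a b where ab: "h = a + w * b" "a \<in> ?B" "b \<in> ?B" using h(1) alg' by blast
    \<comment> \<open>In these terms \<open>?B + w * ?B = ?B + y * ?B\<close>; multiplying by \<open>y\<close> isolates \<open>c\<close>.\<close>
    define c d where "c = a + p * b" and "d = p * b"
    have cd: "c \<in> ?B" "d \<in> ?B" "h = c + y * d"
      using ab adapted_alg_mult[OF A p(1)] alg_add pS y_S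
      by (auto simp: c_def d_def w_def distrib_left distrib_right commute[of p y] mult.assoc add.assoc)
    have q: "prod_list xs \<in> S" "prod_list xs * (y * z) = x * (prod_list xs * z)" for z
      using y(3,4)[OF False] xS(1) by (simp_all add: commute[of x] flip: mult.assoc)
    show ?thesis
    proof
      assume 0: "prod_list xs * h = 0"
      have "y * (y * d) = 0" using y_S by (simp flip: mult.assoc)
      hence "x * (prod_list xs * c) = prod_list xs * (y * (c + y * d))"
        by (simp only: distrib_left add_0_right q(2))
      also have "\<dots> = y * (prod_list xs * h)" using cd(3) y_S q(1) by (simp add: left_commute)
      finally have "x * (prod_list xs * c) = 0" using 0 by simp
      hence "c = 0" using inj[OF cd(1)] by blast
      hence "x * (prod_list xs * d) = 0" using 0 cd(3) q(2) by simp
      hence "d = 0" using inj[OF cd(2)] by blast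
      thus False using \<open>c = 0\<close> cd(3) h(2) by simp
    qed
  qed (use h in auto)
  moreover have "length xs = card ({1..n} - insert i A)"
    using Cons.prems(2) i by (simp add: card_Diff_insert)
  moreover have "\<exists>q\<in>alg ?u (insert i A). q * q = scale (\<alpha> j) 1" if j: "j \<in> {1..n} - insert i A" for j
  proof -
    obtain q where q: "q \<in> ?B" "q * q = scale (\<alpha> j) 1" using Cons.prems(5) j by blast
    have "q + w * 0 \<in> alg ?u (insert i A)" using q(1) alg_zero alg' by blast
    thus ?thesis using q(2) by auto
  qed
  ultimately show ?case using Cons.IH[OF A' _ xS(3)] by blast
qed

text \<open>
  The first stage. An adapted family that generates a field is chosen with as many members as
  possible. If \<open>\<alpha> i\<close> were not a square in that field, then \<open>e {i}\<close>, corrected by a multiple of \<open>x\<close> that makes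
  it orthogonal to the field, could be adjoined.
\<close>

lemma adapted_residue_field:
  assumes x: "x \<in> nil" "x \<noteq> 0"
  obtains A u where "adapted A u" "\<And>h. h \<in> alg u A \<Longrightarrow> h * h = 0 \<Longrightarrow> h = 0"
    "\<And>i. i \<in> {1..n} - A \<Longrightarrow> \<exists>p\<in>alg u A. p * p = scale (\<alpha> i) 1"
proof -
  define Q where "Q A \<longleftrightarrow> (\<exists>u. adapted A u \<and> (\<forall>h\<in>alg u A. h * h = 0 \<longrightarrow> h = 0))" for A
  have "Q {}"
    by (auto simp: Q_def adapted_def alg_empty scalars_def)
  moreover have "\<forall>A. Q A \<longrightarrow> card A < Suc n"
    by (auto simp: Q_def adapted_def less_Suc_eq_le dest!: card_mono[rotated])
  ultimately obtain A where QA: "Q A" and max: "\<And>A'. Q A' \<Longrightarrow> card A' \<le> card A"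
    using ex_has_greatest_nat[of Q "{}" card "Suc n"] by auto
  then obtain u where A: "adapted A u" and field: "\<And>h. h \<in> alg u A \<Longrightarrow> h * h = 0 \<Longrightarrow> h = 0"
    by (auto simp: Q_def)
  let ?B = "alg u A"
  have BS: "?B \<subseteq> S" using adapted_alg_S[OF A] by blast
  have "\<exists>p\<in>?B. p * p = scale (\<alpha> i) 1" if i: "i \<in> {1..n} - A" for i
  proof (rule ccontr)
    assume no: "\<not> ?thesis"
    have ei: "e {i} \<in> S" "e {i} * e {i} = scale (\<alpha> i) 1"
      using i e_in_S e_square[of "{i}"] by auto
    have xS: "x \<in> S" "x * x = 0" using x by (auto simp: nil_iff)
    have "x * h \<noteq> 0" if "h \<in> ?B" "h \<noteq> 0" for h
      using unit_mult_nonzero[of h x] field that BS x(2) by blast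
    then obtain v where v: "v \<in> S" "\<forall>h\<in>?B. s (x * v * h) = s (e {i} * h)"
      using realize_functional[OF alg_subspace xS(1) BS _ functional_mult[of "e {i}"]] by blast
    define w where "w = e {i} + x * v"
    have wS: "w \<in> S" using ei xS v by (simp add: w_def S_add S_mult)
    have w2: "w * w = scale (\<alpha> i) 1"
      using ei xS v by (simp add: w_def square_add square_mult[of x v] S_mult)
    have sw: "s (w * h) = 0" if "h \<in> ?B" for h
      using that v(2) s_add_self by (simp add: w_def distrib_right s.add)
    have A': "adapted (insert i A) (u(i := w))"
      and alg': "alg (u(i := w)) (insert i A) = {a + w * b | a b. a \<in> ?B \<and> b \<in> ?B}"
      using adapted_insert[OF A _ _ wS w2 sw] i by auto
    have "h = 0" if h: "h \<in> alg (u(i := w)) (insert i A)" "h * h = 0" for h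
    proof -
      obtain a b where ab: "h = a + w * b" "a \<in> ?B" "b \<in> ?B" using h(1) alg' by blast
      have S: "a \<in> S" "b \<in> S" using ab BS by auto
      have eq: "a * a = (w * b) * (w * b)"
        using h(2) S wS by (simp add: ab(1) square_add S_mult add_cancel_eq)
      \<comment> \<open>Otherwise \<open>a / b\<close> would be a square root of \<open>\<alpha> i\<close> in \<open>?B\<close>.\<close>
      have "b = 0"
      proof (rule ccontr)
        assume "b \<noteq> 0"
        then obtain c where c: "c \<in> ?B" "b * c = 1"
          using inverse_in_subspace[OF S(2) _ alg_subspace ab(3)] field ab(3) by blast
        have cS: "c \<in> S" using c BS by blast
        have "(a * c) * (a * c) = (w * b) * (w * b) * (c * c)"
          using S cS by (simp add: square_mult[of a c] eq)
        also have "\<dots> = (w * b * c) * (w * b * c)"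
          using S cS wS by (simp add: square_mult[of "w * b" c] S_mult)
        finally have "(a * c) * (a * c) = scale (\<alpha> i) 1"
          using c(2) w2 by (simp add: mult.assoc[of w b c])
        thus False using no adapted_alg_mult[OF A ab(2) c(1)] by blast
      qed
      moreover from this have "a = 0" using eq field[OF ab(2)] by simp
      ultimately show "h = 0" using ab(1) by simp
    qed
    hence "Q (insert i A)" using A' unfolding Q_def by blast
    thus False using max[of "insert i A"] i adapted_finite[OF A] by simp
  qed
  thus ?thesis using that A field by blast
qed

text \<open>
  Both elements have the same square.
\<close>

lemma e_congruent_product:
  assumes "I \<subseteq> {1..n}" "\<And>i. i \<in> I \<Longrightarrow> p i \<in> S \<and> p i * p i = scale (\<alpha> i) 1"
  shows "e I + ordered_prod p I \<in> nil"
proof -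
  have "ordered_prod p I \<in> S"
    using assms finite_sub by (intro ordered_prod_in_S) auto
  moreover have "ordered_prod p I * ordered_prod p I = scale (\<Prod>i\<in>I. \<alpha> i) 1"
    using assms finite_sub by (intro ordered_prod_square) auto
  ultimately show ?thesis using assms(1) by (simp add: nil_add_iff e_in_S e_square)
qed

text \<open>
  Modulo nilpotents, \<open>e I\<close> is the product of square roots of the \<open>\<alpha> i\<close>, all of which exist in
  \<open>alg u A\<close>; and the \<open>e I\<close> span \<open>S\<close>.
\<close>

lemma lift_residues:
  assumes A: "adapted A u"
    and roots: "\<And>i. i \<in> {1..n} - A \<Longrightarrow> \<exists>p\<in>alg u A. p * p = scale (\<alpha> i) 1"
    and v: "v \<in> S"
  shows "\<exists>b\<in>alg u A. v + b \<in> nil"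
proof -
  let ?B = "alg u A"
  have "\<exists>p\<in>?B. p * p = scale (\<alpha> i) 1" if "i \<in> {1..n}" for i
    using roots that A generator_in_alg[OF adapted_finite[OF A], of i u]
    by (cases "i \<in> A") (auto simp: adapted_def)
  then obtain p where p: "\<And>i. i \<in> {1..n} \<Longrightarrow> p i \<in> ?B \<and> p i * p i = scale (\<alpha> i) 1"
    by metis
  have list: "prod_list (map p js) \<in> ?B" if "set js \<subseteq> {1..n}" for js
    using that by (induction js) (auto simp: alg_one adapted_alg_mult[OF A] p)
  have "e I \<in> {v \<in> S. \<exists>b\<in>?B. v + b \<in> nil}" if I: "I \<subseteq> {1..n}" for I
  proof -
    have "ordered_prod p I \<in> ?B"
      using list I finite_sub[OF I] by (simp add: ordered_prod_def)
    moreover have "e I + ordered_prod p I \<in> nil"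
      using I p adapted_alg_S[OF A] by (intro e_congruent_product) auto
    ultimately show ?thesis using e_in_S[OF I] by blast
  qed
  moreover have "subspace {v \<in> S. \<exists>b\<in>?B. v + b \<in> nil}"
  proof (rule subspaceI)
    show "0 \<in> {v \<in> S. \<exists>b\<in>?B. v + b \<in> nil}"
      using S_zero alg_zero nil_zero by force
  next
    fix v w assume "v \<in> {v \<in> S. \<exists>b\<in>?B. v + b \<in> nil}" "w \<in> {v \<in> S. \<exists>b\<in>?B. v + b \<in> nil}"
    then obtain b c where "v \<in> S" "w \<in> S" "b \<in> ?B" "c \<in> ?B" "v + b \<in> nil" "w + c \<in> nil" by blast
    moreover from this have "(v + w) + (b + c) \<in> nil"
      using nil_add[of "v + b" "w + c"] by (simp add: add_ac)
    ultimately show "v + w \<in> {v \<in> S. \<exists>b\<in>?B. v + b \<in> nil}"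
      using S_add alg_add by blast
  next
    fix c v assume "v \<in> {v \<in> S. \<exists>b\<in>?B. v + b \<in> nil}"
    then obtain b where b: "v \<in> S" "b \<in> ?B" "v + b \<in> nil" by blast
    hence "scale c v + scale c b \<in> nil"
      using nil_mult(1)[OF b(3), of "scale c 1"] S_scale[OF S_one] by (simp add: scale_right_distrib)
    thus "scale c v \<in> {v \<in> S. \<exists>b\<in>?B. v + b \<in> nil}"
      using b S_scale alg_scale by blast
  qed
  ultimately have "span (e ` Pow {1..n}) \<subseteq> {v \<in> S. \<exists>b\<in>?B. v + b \<in> nil}"
    by (intro span_minimal) auto
  thus ?thesis using v S_span by blast
qed

text \<open>
  Here \<open>e I\<close> equals the product of the \<open>e {i}\<close>, and \<open>e {} = 1\<close>; so the claim is orthogonality to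
  \<open>e {}\<close>.
\<close>

lemma adapted_of_reduced:
  assumes "nil = {0}"
  shows "adapted {1..n} (\<lambda>i. e {i})"
proof -
  have e: "e {i} \<in> S \<and> e {i} * e {i} = scale (\<alpha> i) 1" if "i \<in> {1..n}" for i
    using that e_in_S e_square[of "{i}"] by auto
  have eq: "e I = ordered_prod (\<lambda>i. e {i}) I" if I: "I \<subseteq> {1..n}" for I
  proof -
    have "e I + ordered_prod (\<lambda>i. e {i}) I \<in> nil"
      using e I by (intro e_congruent_product) blast+
    thus ?thesis using assms by (simp add: add_cancel_eq)
  qed
  have "s (ordered_prod (\<lambda>i. e {i}) I) = 0" if I: "I \<subseteq> {1..n}" "I \<noteq> {}" for I
    using e_orthogonal[OF I(1), of "{}"] I(2) eq[of "{}"] eq[OF I(1)] by simp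
  thus ?thesis using e by (auto simp: adapted_def)
qed

lemma ordered_prod_union:
  assumes "finite I" "finite J" "I \<inter> J = {}" "\<And>i. i \<in> I \<union> J \<Longrightarrow> u i \<in> S"
  shows "ordered_prod u (I \<union> J) = ordered_prod u I * ordered_prod u J"
  using assms
proof (induction I)
  case (insert i I)
  have "ordered_prod u (insert i (I \<union> J)) = u i * ordered_prod u (I \<union> J)"
    using insert by (intro ordered_prod_insert) auto
  moreover have "ordered_prod u (insert i I) = u i * ordered_prod u I"
    using insert by (intro ordered_prod_insert) auto
  ultimately show ?case using insert by (simp add: mult.assoc)
qed simp

text \<open>
  The common factors of the two products square to a scalar, which leaves the product over the
  symmetric difference.
\<close>

lemma adapted_orthogonal:
  assumes u: "adapted {1..n} u" and IJ: "I \<subseteq> {1..n}" "J \<subseteq> {1..n}"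
  shows "s (ordered_prod u I * ordered_prod u J) = (if I = J then \<Prod>i\<in>I. \<alpha> i else 0)"
proof -
  let ?P = "ordered_prod u"
  have S: "u i \<in> S" if "i \<in> {1..n}" for i using adapted_in_S[OF u that] .
  have PS: "?P K \<in> S" if "K \<subseteq> {1..n}" for K
    using that S finite_sub by (intro ordered_prod_in_S) auto
  have union: "?P (K \<union> L) = ?P K * ?P L" if "K \<subseteq> {1..n}" "L \<subseteq> {1..n}" "K \<inter> L = {}" for K L
    using that S by (intro ordered_prod_union) (auto intro: finite_sub)
  have square: "?P K * ?P K = scale (\<Prod>i\<in>K. \<alpha> i) 1" if "K \<subseteq> {1..n}" for K
    using that u finite_sub by (intro ordered_prod_square) (auto simp: adapted_def)
  define K where "K = (I - J) \<union> (J - I)"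
  have sub: "I \<inter> J \<subseteq> {1..n}" "I - J \<subseteq> {1..n}" "J - I \<subseteq> {1..n}" "K \<subseteq> {1..n}"
    using IJ by (auto simp: K_def)
  have "?P ((I \<inter> J) \<union> (I - J)) = ?P (I \<inter> J) * ?P (I - J)"
    "?P ((I \<inter> J) \<union> (J - I)) = ?P (I \<inter> J) * ?P (J - I)"
    using sub by (auto intro!: union)
  moreover have "(I \<inter> J) \<union> (I - J) = I" "(I \<inter> J) \<union> (J - I) = J" by blast+
  ultimately have "?P I = ?P (I \<inter> J) * ?P (I - J)" "?P J = ?P (I \<inter> J) * ?P (J - I)"
    by simp_all
  hence "?P I * ?P J = (?P (I \<inter> J) * ?P (I \<inter> J)) * (?P (I - J) * ?P (J - I))"
    using PS sub by (simp add: left_commute mult.assoc)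
  also have "?P (I - J) * ?P (J - I) = ?P K"
    unfolding K_def using sub by (subst union) auto
  finally have eq: "s (?P I * ?P J) = (\<Prod>i\<in>I \<inter> J. \<alpha> i) * s (?P K)"
    using square sub(1) by (simp add: s.scale)
  show ?thesis
  proof (cases "I = J")
    case True
    thus ?thesis using eq by (simp add: K_def s_one)
  next
    case False
    hence "K \<noteq> {}" by (auto simp: K_def)
    thus ?thesis using eq False u sub(4) by (simp add: adapted_def)
  qed
qed

lemma adapted_generates:
  assumes u: "adapted {1..n} u"
  shows "alg u {1..n} = S"
proof
  show "alg u {1..n} \<subseteq> S" using adapted_alg_S[OF u] by blast
  let ?X = "ordered_prod u ` Pow {1..n}" and ?E = "e ` Pow {1..n}"
  have X: "independent ?X" "card ?X = 2 ^ n" and E: "card ?E = 2 ^ n"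
    using orthogonal_family_independent[of "ordered_prod u"] adapted_orthogonal[OF u]
      orthogonal_family_independent[of e] e_orthogonal by auto
  have "?X \<subseteq> alg u {1..n}" by (auto simp: ordered_prod_in_alg)
  hence "?X \<subseteq> S" using adapted_alg_S[OF u] by blast
  show "S \<subseteq> alg u {1..n}"
  proof
    fix v assume v: "v \<in> S"
    show "v \<in> alg u {1..n}"
    proof (rule ccontr)
      assume no: "v \<notin> alg u {1..n}"
      hence "independent (insert v ?X)" using X(1) by (simp add: independent_insert alg_def)
      hence "card (insert v ?X) \<le> card ?E"
        using independent_span_bound[of ?E "insert v ?X"] v \<open>?X \<subseteq> S\<close> S_span by auto
      moreover have "v \<notin> ?X" using no \<open>?X \<subseteq> alg u {1..n}\<close> by blast
      ultimately show False using X(2) E by simp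
    qed
  qed
qed

end

section \<open>Minimum rank and Loewy length\<close>

lemma ring_of_simps [simp]:
  "carrier (ring_of B) = B" "mult (ring_of B) = (*)" "one (ring_of B) = 1"
  "zero (ring_of B) = 0" "add (ring_of B) = (+)"
  by (simp_all add: ring_of_def)

context unital_algebra
begin

lemma subalgebra_UNIV: "is_subalgebra scale UNIV"
  by (simp add: is_subalgebra_def)

lemma ring_ring_of:
  assumes "is_subalgebra scale B"
  shows "ring (ring_of B)"
proof -
  have B: "subspace B" "1 \<in> B" "\<And>x y. x \<in> B \<Longrightarrow> y \<in> B \<Longrightarrow> x * y \<in> B"
    using assms by (auto simp: is_subalgebra_def)
  show ?thesis
  proof (intro ringI abelian_groupI monoidI; simp add: subspace_add[OF B(1)] subspace_0[OF B(1)] B add.assoc mult.assoc distrib_left distrib_right)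
    show "\<exists>y\<in>B. y + x = 0" if "x \<in> B" for x
      using subspace_neg[OF B(1) that] by force
  qed
qed

lemma a_inv_ring_of:
  assumes "is_subalgebra scale B" "x \<in> B"
  shows "a_inv (ring_of B) x = - x"
proof -
  interpret ring "ring_of B" by (rule ring_ring_of[OF assms(1)])
  have "- x \<in> B" using assms subspace_neg by (auto simp: is_subalgebra_def)
  thus ?thesis using minus_equality[of "- x" x] assms(2) by simp
qed

lemma generated_in_subalgebra:
  assumes "is_subalgebra scale B" "is_subalgebra scale C" "C \<subseteq> B" "X \<subseteq> C"
  shows "generated_algebra (\<lambda>c. scale c 1) (ring_of B) X \<subseteq> C"
proof
  have C: "subspace C" "1 \<in> C" "\<And>x y. x \<in> C \<Longrightarrow> y \<in> C \<Longrightarrow> x * y \<in> C"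
    using assms by (auto simp: is_subalgebra_def)
  fix x assume "x \<in> generated_algebra (\<lambda>c. scale c 1) (ring_of B) X"
  thus "x \<in> C"
    unfolding generated_algebra_def
  proof (induction rule: generate_ring.induct)
    case (incl h)
    thus ?case using C assms(4) subspace_scale by blast
  next
    case (a_inv h)
    thus ?case using a_inv_ring_of[OF assms(1)] assms(3) C(1) subspace_neg by auto
  qed (simp_all add: C subspace_add)
qed

lemma generated_subspace:
  "subspace (generated_algebra (\<lambda>c. scale c 1) (ring_of B) X)" (is "subspace ?G")
proof -
  have scalar: "scale c 1 \<in> ?G" for c
    unfolding generated_algebra_def by (rule generate_ring.incl) simp
  have "scale c x \<in> ?G" if "x \<in> ?G" for c x
  proof -
    have "scale c 1 * x \<in> ?G"
      using generate_ring.eng_mult[OF scalar[unfolded generated_algebra_def] that[unfolded generated_algebra_def]]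
      by (simp add: generated_algebra_def)
    thus ?thesis by (simp add: mult_scale_left)
  qed
  moreover have "x + y \<in> ?G" if "x \<in> ?G" "y \<in> ?G" for x y
    using generate_ring.eng_add[OF that[unfolded generated_algebra_def]]
    by (simp add: generated_algebra_def)
  moreover have "0 \<in> ?G" using scalar[of 0] by simp
  ultimately show ?thesis by (simp add: subspace_def)
qed

lemma ordered_prod_in_generated:
  assumes "finite I" "\<And>i. i \<in> I \<Longrightarrow> u i \<in> X"
  shows "ordered_prod u I \<in> generated_algebra (\<lambda>c. scale c 1) (ring_of B) X"
proof -
  have "set js \<subseteq> I \<Longrightarrow> prod_list (map u js) \<in> generated_algebra (\<lambda>c. scale c 1) (ring_of B) X" for js
  proof (induction js)
    case Nil
    thus ?case using generate_ring.one[of "ring_of B"] by (simp add: generated_algebra_def)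
  next
    case (Cons j js)
    thus ?case
      using generate_ring.eng_mult[of "u j" "ring_of B"] assms(2)
      by (simp add: generated_algebra_def generate_ring.incl)
  qed
  thus ?thesis using assms(1) by (simp add: ordered_prod_def)
qed

end

context conic_subalgebra
begin

lemma alg_subalgebra:
  assumes "finite A" "\<And>i. i \<in> A \<Longrightarrow> u i \<in> S"
  shows "is_subalgebra scale (alg u A)"
  using alg_mult[OF assms] by (auto simp: is_subalgebra_def alg_subspace alg_one)

lemma generated_eq_alg:
  assumes "is_subalgebra scale B" "S \<subseteq> B" "finite A" "\<And>i. i \<in> A \<Longrightarrow> u i \<in> S"
  shows "generated_algebra (\<lambda>c. scale c 1) (ring_of B) (u ` A) = alg u A"
proof
  show "generated_algebra (\<lambda>c. scale c 1) (ring_of B) (u ` A) \<subseteq> alg u A"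
    using assms alg_in_S[OF assms(3,4)] generator_in_alg[OF assms(3)]
    by (intro generated_in_subalgebra alg_subalgebra) auto
  have "ordered_prod u ` Pow A \<subseteq> generated_algebra (\<lambda>c. scale c 1) (ring_of B) (u ` A)"
    using assms(3) by (auto intro!: ordered_prod_in_generated dest: finite_subset)
  thus "alg u A \<subseteq> generated_algebra (\<lambda>c. scale c 1) (ring_of B) (u ` A)"
    unfolding alg_def by (rule span_minimal[OF _ generated_subspace])
qed

text \<open>
  As squares are scalars, \<open>r\<close> generators span with at most \<open>2 ^ r\<close> products.
\<close>

lemma min_rank_ge:
  assumes E: "finite E" "independent E" "card E = 2 ^ n" "span E = S"
  shows "n \<le> min_rank (\<lambda>c. scale c 1) (ring_of S)"
proof -
  define r where "r = min_rank (\<lambda>c. scale c 1) (ring_of S)"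
  let ?P = "\<lambda>k. \<exists>X. X \<subseteq> carrier (ring_of S) \<and> finite X \<and> card X = k \<and>
    generated_algebra (\<lambda>c. scale c 1) (ring_of S) X = carrier (ring_of S)"
  have ES: "E \<subseteq> S" using E(4) span_superset by blast
  have "generated_algebra (\<lambda>c. scale c 1) (ring_of S) E = S"
  proof
    show "generated_algebra (\<lambda>c. scale c 1) (ring_of S) E \<subseteq> S"
      using ES by (intro generated_in_subalgebra subalgebra) auto
    have "E \<subseteq> generated_algebra (\<lambda>c. scale c 1) (ring_of S) E"
      by (auto simp: generated_algebra_def generate_ring.incl)
    thus "S \<subseteq> generated_algebra (\<lambda>c. scale c 1) (ring_of S) E"
      using span_minimal[OF _ generated_subspace] E(4) by blast
  qed
  hence "?P (card E)" using E(1) ES by auto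
  hence "?P r" unfolding r_def min_rank_def by (rule LeastI[of ?P])
  then obtain X where X: "X \<subseteq> S" "finite X" "card X = r"
    "generated_algebra (\<lambda>c. scale c 1) (ring_of S) X = S" by auto
  obtain u where "bij_betw u {0..<r} X" using ex_bij_betw_nat_finite[OF X(2)] X(3) by blast
  hence u: "X = u ` {0..<r}" by (auto simp: bij_betw_def)
  let ?M = "ordered_prod u ` Pow {0..<r}"
  have "u i \<in> S" if "i \<in> {0..<r}" for i using X(1) u that by blast
  hence "S = alg u {0..<r}"
    using generated_eq_alg[OF subalgebra order_refl, of "{0..<r}" u] X(4) u by simp
  hence "card E \<le> card ?M"
    using E(2) ES by (intro independent_span_bound[THEN conjunct2]) (auto simp: alg_def)
  also have "\<dots> \<le> card (Pow {0..<r})" by (rule card_image_le) simp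
  finally have "(2::nat) ^ n \<le> 2 ^ r" using E(3) by (simp add: card_Pow)
  thus ?thesis by (simp add: r_def)
qed

lemma nil_ideal: "ideal nil (ring_of S)"
proof (rule idealI[OF ring_ring_of[OF subalgebra]])
  interpret ring "ring_of S" by (rule ring_ring_of[OF subalgebra])
  show "subgroup nil (add_monoid (ring_of S))"
  proof (rule add.subgroupI)
    show "nil \<noteq> {}" using nil_zero by blast
    fix a assume a: "a \<in> nil"
    thus "\<ominus>\<^bsub>ring_of S\<^esub> a \<in> nil"
      using a_inv_ring_of[OF subalgebra nil_in_S[OF a]] by (simp add: uminus_eq)
  qed (auto simp: nil_in_S nil_add)
qed (auto simp: nil_mult)

lemma nil_maximal: "maximalideal nil (ring_of S)"
proof (rule maximalidealI[OF nil_ideal])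
  have "1 \<notin> nil" by (simp add: nil_iff)
  thus "carrier (ring_of S) \<noteq> nil" using S_one by auto
  fix J assume J: "ideal J (ring_of S)" "nil \<subseteq> J" "J \<subseteq> carrier (ring_of S)"
  interpret J: ideal J "ring_of S" by fact
  show "J = nil \<or> J = carrier (ring_of S)"
  proof (cases "J = nil")
    case False
    then obtain x where x: "x \<in> J" "x \<notin> nil" using J(2) by blast
    have xS: "x \<in> S" using x J(3) by auto
    moreover have "x * x \<noteq> 0" using x xS by (simp add: nil_iff)
    ultimately obtain y where y: "y \<in> S" "x * y = 1"
      using inverse_in_subspace[OF _ _ S_subspace] by blast
    hence "1 \<in> J" using J.I_r_closed[of x y] x(1) by simp
    hence "z \<in> J" if "z \<in> S" for z using J.I_r_closed[of 1 z] that by simp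
    thus ?thesis using J(3) by auto
  qed simp
qed

text \<open>
  The Jacobson radical lies in the maximal ideal \<open>nil\<close>. By induction, an element of its \<open>l\<close>-th
  power is annihilated by each product of \<open>d - l\<close> elements of \<open>nil\<close>.
\<close>

lemma loewy_length_le:
  assumes "0 < d" and vanish: "\<And>xs. set xs \<subseteq> nil \<Longrightarrow> length xs = d \<Longrightarrow> prod_list xs = 0"
  shows "loewy_length (ring_of S) \<le> d"
proof -
  let ?R = "ring_of S"
  let ?J = "jacobson_radical ?R"
  have JS: "?J \<subseteq> nil" using nil_maximal by (auto simp: jacobson_radical_def)
  have J0: "0 \<in> ?J"
  proof -
    have "0 \<in> I" if "maximalideal I ?R" for I
      using ideal.axioms(1)[OF maximalideal.axioms(1)[OF that]] additive_subgroup.zero_closed by fastforce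
    thus ?thesis by (auto simp: jacobson_radical_def S_zero)
  qed
  have zero: "0 \<in> ideal_power ?R ?J l" for l
  proof (induction l)
    case (Suc l)
    show ?case using ideal_prod.prod[OF J0 Suc, of ?R] by simp
  qed (simp add: S_zero)
  have "z \<in> S \<and> (\<forall>xs. set xs \<subseteq> nil \<and> length xs = d - l \<longrightarrow> z * prod_list xs = 0)"
    if "z \<in> ideal_power ?R ?J l" "l \<le> d" for z l
    using that
  proof (induction l arbitrary: z)
    case 0
    thus ?case using vanish by simp
  next
    case (Suc l)
    from Suc.prems(1)[unfolded ideal_power.simps] show ?case
    proof (induction rule: ideal_prod.induct)
      case (prod i j)
      have j: "j \<in> S" "\<And>xs. set xs \<subseteq> nil \<and> length xs = d - l \<Longrightarrow> j * prod_list xs = 0"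
        using Suc.IH[OF prod(2)] Suc.prems(2) by auto
      have i: "i \<in> nil" using prod(1) JS by blast
      have "i * j * prod_list xs = 0" if "set xs \<subseteq> nil \<and> length xs = d - Suc l" for xs
      proof -
        have "j * prod_list (i # xs) = 0"
          using that i Suc.prems(2) by (intro j(2)) auto
        thus ?thesis using i j(1) nil_in_S by (simp add: commute[of i j] mult.assoc)
      qed
      thus ?case using i j(1) nil_in_S S_mult by simp
    qed (simp add: S_add distrib_right)
  qed
  from this[of _ d] have "ideal_power ?R ?J d \<subseteq> {0}" by auto
  hence "ideal_power ?R ?J d = {0}" using zero by blast
  thus ?thesis unfolding loewy_length_def using assms(1) by (intro Least_le) simp
qed

text \<open>
  The cosets of the \<open>u i\<close> generate the quotient.
\<close>

lemma quotient_min_rank_le: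
  assumes A: "finite A" "\<And>i. i \<in> A \<Longrightarrow> u i \<in> S"
    and lift: "\<And>v. v \<in> S \<Longrightarrow> \<exists>b\<in>alg u A. v + b \<in> nil"
  shows "min_rank (\<lambda>c. nil +>\<^bsub>ring_of S\<^esub> scale c 1) (ring_of S Quot nil) \<le> card A"
proof -
  let ?R = "ring_of S"
  let ?Q = "?R Quot nil"
  define h where "h = (\<lambda>v. nil +>\<^bsub>?R\<^esub> v)"
  interpret N: ideal nil ?R by (rule nil_ideal)
  interpret Q: ring ?Q by (rule N.quotient_is_ring)
  have h: "h \<in> ring_hom ?R ?Q" unfolding h_def by (rule N.rcos_ring_hom)
  have carrier: "carrier ?Q = h ` S"
    by (auto simp: FactRing_def A_RCOSETS_def' h_def)
  have h_eq: "h v = h b" if "v + b \<in> nil" for v b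
  proof -
    have mem: "(x + (v + b)) + w \<in> h w" if x: "x \<in> nil" for x w
      using nil_add[OF x \<open>v + b \<in> nil\<close>] by (auto simp: h_def a_r_coset_def')
    have "(x + (v + b)) + b = x + v" "(x + (v + b)) + v = x + b" for x
      by (metis add.assoc add_add_self add.commute)+
    with mem have "x + v \<in> h b" "x + b \<in> h v" if "x \<in> nil" for x
      using that by metis+
    thus ?thesis unfolding h_def a_r_coset_def' by auto
  qed
  let ?X = "h ` u ` A"
  define G where "G = generated_algebra (\<lambda>c. h (scale c 1)) ?Q ?X"
  have G: "x \<oplus>\<^bsub>?Q\<^esub> y \<in> G" "x \<otimes>\<^bsub>?Q\<^esub> y \<in> G" if "x \<in> G" "y \<in> G" for x y
    using that by (auto simp: G_def generated_algebra_def intro: generate_ring.intros)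
  have scalar: "h (scale c 1) \<in> G" for c
    unfolding G_def generated_algebra_def by (rule generate_ring.incl) simp
  have hmult: "h (x * y) = h x \<otimes>\<^bsub>?Q\<^esub> h y" if "x \<in> S" "y \<in> S" for x y
    using ring_hom_mult[OF h, of x y] that by simp
  have hadd: "h (x + y) = h x \<oplus>\<^bsub>?Q\<^esub> h y" if "x \<in> S" "y \<in> S" for x y
    using ring_hom_add[OF h, of x y] that by simp
  have "subspace {b \<in> S. h b \<in> G}"
  proof (rule subspaceI)
    show "0 \<in> {b \<in> S. h b \<in> G}" using scalar[of 0] S_zero by simp
    show "x + y \<in> {b \<in> S. h b \<in> G}" if "x \<in> {b \<in> S. h b \<in> G}" "y \<in> {b \<in> S. h b \<in> G}" for x y
      using that G(1) by (simp add: hadd S_add)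
    show "scale c x \<in> {b \<in> S. h b \<in> G}" if "x \<in> {b \<in> S. h b \<in> G}" for c x
      using that G(2)[OF scalar] hmult[OF S_scale[OF S_one], of x c] by (simp add: S_scale)
  qed
  moreover have "prod_list (map u js) \<in> {b \<in> S. h b \<in> G}" if "set js \<subseteq> A" for js
    using that
  proof (induction js)
    case Nil
    thus ?case using scalar[of 1] S_one by simp
  next
    case (Cons j js)
    have "h (u j) \<in> G"
      using Cons.prems unfolding G_def generated_algebra_def by (intro generate_ring.incl) auto
    thus ?case using Cons A(2) G(2) by (simp add: S_mult hmult)
  qed
  hence "ordered_prod u ` Pow A \<subseteq> {b \<in> S. h b \<in> G}"
    using A(1) by (auto simp: ordered_prod_def finite_subset)
  ultimately have "alg u A \<subseteq> {b \<in> S. h b \<in> G}"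
    unfolding alg_def by (intro span_minimal)
  hence "carrier ?Q \<subseteq> G" using lift h_eq carrier by fastforce
  moreover have "G \<subseteq> carrier ?Q"
    unfolding G_def generated_algebra_def
    using A(2) carrier S_scale[OF S_one] by (intro Q.generate_ring_incl) auto
  ultimately have "\<exists>X. X \<subseteq> carrier ?Q \<and> finite X \<and> card X = card ?X \<and>
      generated_algebra (\<lambda>c. h (scale c 1)) ?Q X = carrier ?Q"
    using A carrier unfolding G_def by (intro exI[of _ ?X]) auto
  hence "min_rank (\<lambda>c. h (scale c 1)) ?Q \<le> card ?X"
    unfolding min_rank_def by (rule Least_le)
  also have "card ?X \<le> card A"
    using A(1) by (metis card_image_le finite_imageI le_trans)
  finally show ?thesis by (simp add: h_def)
qed

end

context pfister_functional
begin

text \<open>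
  If all products of \<open>n - card A\<close> nilpotents vanished, the Loewy length would be at most
  \<open>n - card A\<close>, so that \<open>n \<le> (n - card A) + card A - 1\<close> by \<open>\<rho>\<close>-generation.
\<close>

lemma nonzero_nil_product:
  assumes rho: "rho_generated scale S" and A: "adapted A u" "A \<noteq> {1..n}"
    and roots: "\<And>i. i \<in> {1..n} - A \<Longrightarrow> \<exists>p\<in>alg u A. p * p = scale (\<alpha> i) 1"
  obtains xs where "set xs \<subseteq> nil" "length xs = n - card A" "prod_list xs \<noteq> 0"
proof (rule ccontr)
  assume none: "\<not> thesis"
  note product = that
  have vanish: "prod_list xs = 0" if xs: "set xs \<subseteq> nil" "length xs = n - card A" for xs
    using none product[OF xs] by blast
  have "A \<subset> {1..n}" using A by (auto simp: adapted_def)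
  hence lt: "card A < n" using psubset_card_mono[of "{1..n}" A] by simp
  hence "loewy_length (ring_of S) \<le> n - card A" using vanish by (intro loewy_length_le) auto
  moreover have "min_rank (\<lambda>c. nil +>\<^bsub>ring_of S\<^esub> scale c 1) (ring_of S Quot nil) \<le> card A"
    using A(1) adapted_finite adapted_in_S lift_residues[OF A(1) roots]
    by (intro quotient_min_rank_le) auto
  moreover have "n \<le> min_rank (\<lambda>c. scale c 1) (ring_of S)"
    using orthogonal_family_independent[of e] e_orthogonal S_span
    by (intro min_rank_ge[of "e ` Pow {1..n}"]) auto
  ultimately show False using rho lt by (simp add: rho_generated_def Let_def)
qed

theorem exists_adapted:
  assumes rho: "rho_generated scale S"
  shows "\<exists>u. adapted {1..n} u"
proof (cases "nil = {0}")
  case True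
  thus ?thesis using adapted_of_reduced by blast
next
  case False
  then obtain x where x: "x \<in> nil" "x \<noteq> 0" using nil_zero by blast
  obtain A u where A: "adapted A u" and field: "\<And>h. h \<in> alg u A \<Longrightarrow> h * h = 0 \<Longrightarrow> h = 0"
    and roots: "\<And>i. i \<in> {1..n} - A \<Longrightarrow> \<exists>p\<in>alg u A. p * p = scale (\<alpha> i) 1"
    using adapted_residue_field[OF x] by blast
  show ?thesis
  proof (cases "A = {1..n}")
    case True
    thus ?thesis using A by blast
  next
    case False
    then obtain xs where xs: "set xs \<subseteq> nil" "length xs = n - card A" "prod_list xs \<noteq> 0"
      using nonzero_nil_product[OF rho A _ roots] by blast
    have "A \<subseteq> {1..n}" using A by (simp add: adapted_def)
    hence "length xs = card ({1..n} - A)"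
      using xs(2) adapted_finite[OF A] by (simp add: card_Diff_subset)
    moreover have "prod_list xs * h \<noteq> 0" if "h \<in> alg u A" "h \<noteq> 0" for h
      using unit_mult_nonzero[OF adapted_alg_S[OF A that(1)] _ xs(3)] field that by blast
    ultimately show ?thesis using complete_adapted[OF A _ xs(1) _ roots] by blast
  qed
qed

end

section \<open>The form attached to an orthogonal involution\<close>

lemma diag_tensor_pair:
  "diag_tensor [1, a] ds = ds @ map ((*) a) ds"
  by (simp add: diag_tensor_def map_idI)

lemma length_pfister_entries: "length (pfister_entries as) = 2 ^ length as"
  by (induction as) (simp_all add: diag_tensor_pair)

text \<open>
  Position and set of slots correspond as in binary notation: the first slot contributes the leading
  digit, because tensoring with \<open>\<langle>1, a\<rangle>\<close> appends to the list of entries its multiple by \<open>a\<close>.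
\<close>

lemma pfister_entries_index:
  assumes "distinct is"
  obtains J where "bij_betw J (Pow (set is)) {..<2 ^ length is}"
    "\<And>I. I \<subseteq> set is \<Longrightarrow> pfister_entries (map \<alpha> is) ! J I = (\<Prod>i\<in>I. \<alpha> i)"
proof -
  have "\<exists>J. bij_betw J (Pow (set is)) {..<2 ^ length is} \<and>
    (\<forall>I\<subseteq>set is. pfister_entries (map \<alpha> is) ! J I = (\<Prod>i\<in>I. \<alpha> i))"
    using assms
  proof (induction "is")
    case Nil
    show ?case by (rule exI[of _ "\<lambda>_. 0"]) (auto simp: bij_betw_def)
  next
    case (Cons i "is")
    let ?ds = "pfister_entries (map \<alpha> is)" and ?N = "2 ^ length is :: nat"
    obtain J where J: "bij_betw J (Pow (set is)) {..<?N}"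
      "\<And>I. I \<subseteq> set is \<Longrightarrow> ?ds ! J I = (\<Prod>i\<in>I. \<alpha> i)" using Cons by auto
    have i: "i \<notin> set is" using Cons.prems by simp
    have less: "J I < ?N" if "I \<subseteq> set is" for I
      using J(1) that by (auto simp: bij_betw_def)
    have inj: "I = I'" if "J I = J I'" "I \<subseteq> set is" "I' \<subseteq> set is" for I I'
      using J(1) that by (auto simp: bij_betw_def inj_on_def)
    define J' where "J' I = (if i \<in> I then ?N + J (I - {i}) else J I)" for I
    have sub: "I - {i} \<subseteq> set is" "i \<notin> I \<Longrightarrow> I \<subseteq> set is" if "I \<subseteq> set (i # is)" for I
      using that by auto
    have "inj_on J' (Pow (set (i # is)))"
    proof (rule inj_onI)
      fix I I' assume I: "I \<in> Pow (set (i # is))" "I' \<in> Pow (set (i # is))" "J' I = J' I'"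
      hence eq: "i \<in> I \<longleftrightarrow> i \<in> I'"
        using less[of I] less[of I'] sub(2)[of I] sub(2)[of I'] by (auto simp: J'_def split: if_splits)
      show "I = I'"
      proof (cases "i \<in> I")
        case True
        hence "I - {i} = I' - {i}"
          using I eq sub(1)[of I] sub(1)[of I'] by (intro inj) (auto simp: J'_def)
        thus ?thesis using True eq by blast
      next
        case False
        thus ?thesis using I eq sub(2) by (intro inj) (auto simp: J'_def)
      qed
    qed
    moreover have "J' ` Pow (set (i # is)) \<subseteq> {..<2 * ?N}"
    proof safe
      fix I assume "I \<subseteq> set (i # is)"
      thus "J' I < 2 * ?N"
        using less[OF sub(1), of I] less[OF sub(2), of I] by (auto simp: J'_def)
    qed
    moreover have "card (Pow (set (i # is))) = 2 * ?N"
      using i Cons.prems by (simp add: card_Pow distinct_card)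
    ultimately have "J' ` Pow (set (i # is)) = {..<2 * ?N}"
      by (intro card_subset_eq) (simp_all add: card_image)
    with \<open>inj_on J' _\<close> have "bij_betw J' (Pow (set (i # is))) {..<2 ^ length (i # is)}"
      by (simp add: bij_betw_def)
    moreover have "pfister_entries (map \<alpha> (i # is)) ! J' I = (\<Prod>i\<in>I. \<alpha> i)"
      if I: "I \<subseteq> set (i # is)" for I
    proof (cases "i \<in> I")
      case True
      have "finite I" using I finite_subset by blast
      hence "(\<Prod>i\<in>I. \<alpha> i) = \<alpha> i * (\<Prod>i\<in>I - {i}. \<alpha> i)" using True by (simp add: prod.remove)
      thus ?thesis
        using True less[OF sub(1)[OF I]] J(2)[OF sub(1)[OF I]]
        by (simp add: J'_def diag_tensor_pair nth_append length_pfister_entries)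
    next
      case False
      thus ?thesis using less[OF sub(2)[OF I]] J(2)[OF sub(2)[OF I]]
        by (simp add: J'_def diag_tensor_pair nth_append length_pfister_entries)
    qed
    ultimately show ?case by blast
  qed
  thus ?thesis using that by blast
qed

lemma diag_form_add: "diag_form ds (x + y) z = diag_form ds x z + diag_form ds y z"
  by (simp add: diag_form_def sum.distrib[symmetric] distrib_left distrib_right)

lemma diag_form_scale: "diag_form ds (coord_scale c x) z = c * diag_form ds x z"
  by (simp add: diag_form_def coord_scale_def sum_distrib_left mult_ac)

definition unit_coord :: "nat \<Rightarrow> nat \<Rightarrow> 'f::field" where
  "unit_coord j = (\<lambda>k. if k = j then 1 else 0)"

lemma diag_form_unit_coord:
  assumes "j < length ds"
  shows "diag_form ds (unit_coord j) (unit_coord k) = (if j = k then ds ! j else 0)"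
proof -
  have "diag_form ds (unit_coord j) (unit_coord k) =
      (\<Sum>l<length ds. if l = j then (if j = k then ds ! j else 0) else 0)"
    unfolding diag_form_def unit_coord_def by (intro sum.cong) auto
  thus ?thesis using assms by simp
qed

context unital_algebra
begin

lemma Alt_subspace:
  assumes "involution_first_kind scale \<sigma>"
  shows "subspace (Alt \<sigma>)"
proof -
  have add: "\<sigma> (x + y) = \<sigma> x + \<sigma> y" and mult: "\<sigma> (x * y) = \<sigma> y * \<sigma> x"
    and scalar: "\<sigma> (scale c 1) = scale c 1" for x y c
    using assms by (auto simp: involution_first_kind_def)
  have scale: "\<sigma> (scale c x) = scale c (\<sigma> x)" for c x
    using mult[of "scale c 1" x] by (simp add: scalar mult_scale_left mult_scale_right)
  show ?thesis
  proof (rule subspaceI)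
    show "0 \<in> Alt \<sigma>"
      unfolding Alt_def using add[of 0 0] by (auto intro!: exI[of _ 0])
    fix x y assume "x \<in> Alt \<sigma>" "y \<in> Alt \<sigma>"
    then obtain a b where "x = a - \<sigma> a" "y = b - \<sigma> b" by (auto simp: Alt_def)
    hence "x + y = (a + b) - \<sigma> (a + b)" by (simp add: add)
    thus "x + y \<in> Alt \<sigma>" by (auto simp: Alt_def)
  next
    fix c x assume "x \<in> Alt \<sigma>"
    then obtain a where "x = a - \<sigma> a" by (auto simp: Alt_def)
    hence "scale c x = scale c a - \<sigma> (scale c a)" by (simp add: scale scale_right_diff_distrib)
    thus "scale c x \<in> Alt \<sigma>" by (auto simp: Alt_def)
  qed
qed

lemma alt_form_unique:
  assumes "involution_first_kind scale \<sigma>" "orthogonal_type \<sigma>"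
    and "v + scale c 1 \<in> Alt \<sigma>" "v + scale d 1 \<in> Alt \<sigma>"
  shows "c = d"
proof (rule ccontr)
  assume "c \<noteq> d"
  note sub = Alt_subspace[OF assms(1)]
  have "scale (c - d) 1 \<in> Alt \<sigma>"
    using subspace_diff[OF sub assms(3,4)] by (simp add: scale_left_diff_distrib)
  hence "scale (1 / (c - d)) (scale (c - d) 1) \<in> Alt \<sigma>" by (rule subspace_scale[OF sub])
  thus False using \<open>c \<noteq> d\<close> assms(2) by (simp add: orthogonal_type_def)
qed

lemma alt_form_eqI:
  assumes "involution_first_kind scale \<sigma>" "orthogonal_type \<sigma>" "v * w + scale c 1 \<in> Alt \<sigma>"
  shows "alt_form scale \<sigma> v w = c"
  unfolding alt_form_def using alt_form_unique[OF assms(1,2)] assms(3) by (intro the_equality) auto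

lemma linear_extension:
  assumes "subspace S" "\<And>x y. x \<in> S \<Longrightarrow> y \<in> S \<Longrightarrow> g (x + y) = g x + g y"
    "\<And>c x. x \<in> S \<Longrightarrow> g (scale c x) = c * g x"
  obtains h where "module_hom scale (*) h" "\<And>x. x \<in> S \<Longrightarrow> h x = g x"
proof -
  interpret VF: vector_space_pair scale "(*) :: 'f \<Rightarrow> 'f \<Rightarrow> 'f"
    by (intro vector_space_pair.intro vector_space_axioms vector_space_field)
  obtain C where C: "C \<subseteq> S" "independent C" "S \<subseteq> span C"
    using maximal_independent_subset by blast
  obtain h where "Vector_Spaces.linear scale (*) h" and hC: "\<And>x. x \<in> C \<Longrightarrow> h x = g x"
    using VF.linear_independent_extend[OF C(2), of g] by blast
  then interpret h: module_hom scale "(*)" h by (simp add: linear_iff_module_hom)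
  have "g 0 = 0" using assms(3)[OF subspace_0[OF assms(1)], of 0] by simp
  hence "subspace {x \<in> S. h x = g x}"
    using assms by (auto simp: subspace_def h.add h.scale h.zero)
  hence "span C \<subseteq> {x \<in> S. h x = g x}" using C(1) hC by (intro span_minimal) auto
  thus ?thesis using that[OF h.module_hom_axioms] C(3) by blast
qed

end

context conic_subalgebra
begin

text \<open>
  The isometry does more than provide the basis: it shows that \<open>\<ss>\<close> is well defined. If \<open>v\<close> were
  outside \<open>Alt (A, \<sigma>) + F\<close>, then so would be \<open>v + 1\<close>, and the definite descriptions of \<open>\<ss> (v, 1)\<close>
  and \<open>\<ss> (v + 1, 1)\<close> would coincide, being both without witness; but these values differ by
  \<open>\<ss> (1, 1) = 1\<close> because \<open>\<ss>\<close> inherits additivity from the diagonal form.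
\<close>

lemma pfister_functional_of_isometry:
  assumes inv: "involution_first_kind scale \<sigma>" and orth: "orthogonal_type \<sigma>"
    and nonzero: "\<And>i. i \<in> {1..n} \<Longrightarrow> \<alpha> i \<noteq> 0"
    and iso: "isometric scale S (alt_form scale \<sigma>) coord_scale (coord_space (2 ^ n))
       (diag_form (pfister_entries (map \<alpha> [1..<Suc n])))"
  obtains s e where "pfister_functional scale S s n \<alpha> e"
    "\<And>v. v \<in> S \<Longrightarrow> s v = 0 \<Longrightarrow> v \<in> Alt \<sigma>"
proof -
  define ds where "ds = pfister_entries (map \<alpha> [1..<Suc n])"
  define g where "g v = alt_form scale \<sigma> v 1" for v
  have set: "set [1..<Suc n] = {1..n}" by auto
  obtain J where J: "bij_betw J (Pow {1..n}) {..<2 ^ n}"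
    "\<And>I. I \<subseteq> {1..n} \<Longrightarrow> ds ! J I = (\<Prod>i\<in>I. \<alpha> i)"
    using pfister_entries_index[of "[1..<Suc n]" \<alpha>] unfolding set ds_def
    by (auto simp del: upt_Suc)
  have len: "length ds = 2 ^ n" by (simp add: ds_def length_pfister_entries)
  obtain f where f: "bij_betw f S (coord_space (2 ^ n))"
    and f_add: "\<And>x y. x \<in> S \<Longrightarrow> y \<in> S \<Longrightarrow> f (x + y) = f x + f y"
    and f_scale: "\<And>c x. x \<in> S \<Longrightarrow> f (scale c x) = coord_scale c (f x)"
    and f_form: "\<And>x y. x \<in> S \<Longrightarrow> y \<in> S \<Longrightarrow> diag_form ds (f x) (f y) = alt_form scale \<sigma> x y"
    using iso unfolding isometric_def ds_def by blast
  have alt_form: "alt_form scale \<sigma> v w = g (v * w)" for v w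
    by (simp add: g_def alt_form_def)
  have g_add: "g (x + y) = g x + g y" if "x \<in> S" "y \<in> S" for x y
    using that S_one by (simp add: g_def S_add diag_form_add f_add flip: f_form)
  have g_scale: "g (scale c x) = c * g x" if "x \<in> S" for c x
    using that S_one by (simp add: g_def S_scale diag_form_scale f_scale flip: f_form)
  have g_one: "g 1 = 1"
    unfolding g_def using subspace_0[OF Alt_subspace[OF inv]]
    by (intro alt_form_eqI[OF inv orth]) (simp add: double)
  have alternating: "v \<in> Alt \<sigma>" if v: "v \<in> S" "g v = 0" for v
  proof -
    \<comment> \<open>Two descriptions that nothing satisfies denote the same value.\<close>
    have "\<exists>c. v + scale c 1 \<in> Alt \<sigma>"
    proof (rule ccontr)
      assume no: "\<not> ?thesis"
      have "(v + 1) + scale c 1 = v + scale (1 + c) 1" for c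
        by (simp only: scale_left_distrib scale_one add.assoc)
      hence "v + 1 + scale c 1 \<notin> Alt \<sigma>" for c using no by metis
      hence "g (v + 1) = g v" using no by (simp add: g_def alt_form_def)
      thus False using g_add[OF v(1) S_one] g_one by simp
    qed
    then obtain c where c: "v + scale c 1 \<in> Alt \<sigma>" by blast
    hence "g v = c" unfolding g_def by (intro alt_form_eqI[OF inv orth]) simp
    thus ?thesis using c v(2) by simp
  qed
  obtain s where s: "module_hom scale (*) s" and sg: "\<And>x. x \<in> S \<Longrightarrow> s x = g x"
    using linear_extension[OF S_subspace g_add g_scale] by blast
  define e where "e I = inv_into S f (unit_coord (J I))" for I
  have J_less: "J I < 2 ^ n" if "I \<subseteq> {1..n}" for I
    using J(1) that by (auto simp: bij_betw_def)
  have unit: "unit_coord (J I) \<in> f ` S" if "I \<subseteq> {1..n}" for I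
    using f J_less[OF that] by (auto simp: bij_betw_def coord_space_def unit_coord_def)
  have e: "e I \<in> S" "f (e I) = unit_coord (J I)" if "I \<subseteq> {1..n}" for I
    using unit[OF that] by (auto simp: e_def inv_into_into f_inv_into_f)
  have orthogonal: "s (e I * e I') = (if I = I' then \<Prod>i\<in>I. \<alpha> i else 0)"
    if I: "I \<subseteq> {1..n}" "I' \<subseteq> {1..n}" for I I'
  proof -
    have "s (e I * e I') = alt_form scale \<sigma> (e I) (e I')"
      using e(1) I by (simp add: sg S_mult alt_form)
    also have "\<dots> = diag_form ds (unit_coord (J I)) (unit_coord (J I'))"
      using e I by (simp flip: f_form)
    also have "\<dots> = (if J I = J I' then ds ! J I else 0)"
      using J_less[OF I(1)] by (simp add: diag_form_unit_coord len)
    also have "J I = J I' \<longleftrightarrow> I = I'"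
      using J(1) I by (auto simp: bij_betw_def inj_on_def)
    finally show ?thesis using J(2)[OF I(1)] by auto
  qed
  have f_sum: "f (\<Sum>i\<in>T. w i) = (\<lambda>k. \<Sum>i\<in>T. f (w i) k)"
    if "finite T" "\<And>i. i \<in> T \<Longrightarrow> w i \<in> S" for T :: "nat set set" and w
    using that
  proof (induction T)
    case empty
    show ?case using f_scale[OF S_zero, of 0] by (simp add: coord_scale_def)
  next
    case (insert i T)
    have "f (w i + (\<Sum>i\<in>T. w i)) = f (w i) + f (\<Sum>i\<in>T. w i)"
      using insert.prems by (intro f_add S_sum) auto
    thus ?case using insert by (auto simp: fun_eq_iff)
  qed
  have "v \<in> span (e ` Pow {1..n})" if v: "v \<in> S" for v
  proof -
    define w where "w = (\<Sum>I\<in>Pow {1..n}. scale (f v (J I)) (e I))"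
    have "w \<in> S" unfolding w_def using e by (intro S_sum S_scale) auto
    moreover have "f w k = f v k" for k
    proof -
      have "f w k = (\<Sum>I\<in>Pow {1..n}. f v (J I) * unit_coord (J I) k)"
        unfolding w_def using e by (subst f_sum) (auto simp: S_scale f_scale coord_scale_def)
      also have "\<dots> = (\<Sum>j<2 ^ n. f v j * unit_coord j k)"
        by (rule sum.reindex_bij_betw[OF J(1)])
      also have "\<dots> = (\<Sum>j<2 ^ n. if j = k then f v j else 0)"
        by (intro sum.cong) (auto simp: unit_coord_def)
      also have "\<dots> = f v k"
      proof -
        have "f v \<in> coord_space (2 ^ n)" using f v by (auto simp: bij_betw_def)
        thus ?thesis by (simp add: coord_space_def)
      qed
      finally show ?thesis .
    qed
    hence "f w = f v" by blast
    ultimately have "w = v" using f v by (auto simp: bij_betw_def inj_on_def)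
    moreover have "w \<in> span (e ` Pow {1..n})"
      unfolding w_def by (intro span_sum span_scale span_base) auto
    ultimately show ?thesis by simp
  qed
  moreover have "span (e ` Pow {1..n}) \<subseteq> S"
    using e(1) by (intro span_minimal[OF _ S_subspace]) auto
  ultimately have span: "S = span (e ` Pow {1..n})" by blast
  have "pfister_functional scale S s n \<alpha> e"
    by (intro pfister_functional.intro pfister_functional_axioms.intro conic_subalgebra_axioms s
        nonzero e(1) orthogonal span) (simp_all add: sg S_one g_one)
  thus ?thesis using that alternating sg by metis
qed

end

theorem proposition5p6:
  fixes scale :: "'f::field \<Rightarrow> 'a::ring_1 \<Rightarrow> 'a"
    and \<sigma> :: "'a \<Rightarrow> 'a"
    and S :: "'a set"
    and n :: nat
    and \<alpha> :: "nat \<Rightarrow> 'f"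
  assumes "CHAR('f) = 2"
    and "unital_algebra scale"
    and "central_simple scale UNIV"
    and "algebra_degree scale UNIV = 2 ^ n"
    and "involution_first_kind scale \<sigma>"
    and "orthogonal_type \<sigma>"
    and "totally_decomposable scale \<sigma>"
    and "S \<subseteq> Sym \<sigma>"
    and "totally_singular_conic scale S"
    and "rho_generated scale S"
    and "centralizer S = S"
    and "\<forall>i\<in>{1..n}. \<alpha> i \<noteq> 0"
    and "isometric scale S (alt_form scale \<sigma>)
           coord_scale (coord_space (2 ^ n)) (diag_form (pfister_entries (map \<alpha> [1..<Suc n])))"
  shows "\<exists>u. alternating_generators scale \<sigma> S n u \<and> (\<forall>i\<in>{1..n}. (u i)\<^sup>2 = scale (\<alpha> i) 1)"
proof -
  interpret unital_algebra scale by fact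
  interpret conic_subalgebra scale S
  proof
    show "x * y = y * x" if "x \<in> S" "y \<in> S" for x y
      using that assms(11) by (auto simp: centralizer_def)
  qed (use assms(1,9) in \<open>auto simp: totally_singular_conic_def power2_eq_square\<close>)
  obtain s e where "pfister_functional scale S s n \<alpha> e"
    and alternating: "\<And>v. v \<in> S \<Longrightarrow> s v = 0 \<Longrightarrow> v \<in> Alt \<sigma>"
    using pfister_functional_of_isometry[OF assms(5,6) _ assms(13)] assms(12) by blast
  then interpret pfister_functional scale S s n \<alpha> e by simp
  obtain u where u: "adapted {1..n} u" using exists_adapted[OF assms(10)] by blast
  have uS: "u i \<in> S" "u i * u i = scale (\<alpha> i) 1" if "i \<in> {1..n}" for i
    using u that by (auto simp: adapted_def)
  have products: "prod_list (map u js) \<in> Alt \<sigma>"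
    if js: "js \<noteq> []" "sorted_wrt (<) js" "set js \<subseteq> {1..n}" for js
  proof -
    have "ordered_prod u (set js) \<in> S" using js(3) uS(1) by (intro ordered_prod_in_S) auto
    moreover have "s (ordered_prod u (set js)) = 0" using u js by (simp add: adapted_def)
    ultimately show ?thesis using alternating ordered_prod_set[OF js(2)] by metis
  qed
  have "u i \<in> Alt \<sigma> \<inter> Units (ring_of UNIV)" if i: "i \<in> {1..n}" for i
  proof -
    have "u i * scale (1 / \<alpha> i) (u i) = 1" "scale (1 / \<alpha> i) (u i) * u i = 1"
      using \<alpha>_nonzero[OF i] uS(2)[OF i] by (simp_all add: mult_scale_left mult_scale_right)
    hence "u i \<in> Units (ring_of UNIV)" by (auto simp: Units_def)
    thus ?thesis using products[of "[i]"] i by simp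
  qed
  moreover have "S = generated_algebra (\<lambda>c. scale c 1) (ring_of UNIV) (u ` {1..n})"
    using generated_eq_alg[OF subalgebra_UNIV subset_UNIV, of "{1..n}" u] uS(1)
      adapted_generates[OF u] by simp
  ultimately have "alternating_generators scale \<sigma> S n u"
    using products by (simp add: alternating_generators_def)
  thus ?thesis using uS(2) by (auto simp: power2_eq_square)
qed

end
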